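(* The operations $;$ (sequential composition), $\oplus$ (sum), $\mathrm{tr}$ (trace), identities $\mathcal I_m$ and swaps $\mathcal S_{m,n}$ on rightward open MDPs over a fixed action set $A$ satisfy the following equations up to isomorphism of roMDPs, for all roMDPs of the appropriate types: ($;$-Unit) $\mathcal I_m;\mathcal A=\mathcal A=\mathcal A;\mathcal I_n$ for $\mathcal A\colon m\to n$; ($;$-Assoc) $\mathcal A;(\mathcal B;\mathcal C)=(\mathcal A;\mathcal B);\mathcal C$; ($\oplus$-Assoc) $(\mathcal A\oplus\mathcal B)\oplus\mathcal C=\mathcal A\oplus(\mathcal B\oplus\mathcal C)$; (Bifunc1) $\mathcal I_m\oplus\mathcal I_n=\mathcal I_{m+n}$; (Bifunc2) $(\mathcal A\oplus\mathcal B);(\mathcal C\oplus\mathcal D)=(\mathcal A;\mathcal C)\oplus(\mathcal B;\mathcal D)$; (Swap1) $\mathcal S_{m,0}=\mathcal I_m$; (Swap2) $\mathcal S_{l,m+n}=(\mathcal S_{l,m}\oplus\mathcal I_n);(\mathcal I_m\oplus\mathcal S_{l,n})$; (Swap3) $\mathcal S_{m,n};\mathcal S_{n,m}=\mathcal I_{m+n}$; (Vanishing1) $\mathrm{tr}^0_{m,m}(\mathcal I_m)=\mathcal I_m$; (Vanishing2) $\mathrm{tr}^{l_1+l_2}_{m,n}(\mathcal A)=\mathrm{tr}^{l_2}_{m,n}(\mathrm{tr}^{l_1}_{l_2+m,l_2+n}(\mathcal A))$ for $\mathcal A\colon l_1+l_2+m\to l_1+l_2+n$; (Superposing) $\mathrm{tr}^l_{m_1+m_2,n_1+n_2}(\mathcal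 A\oplus\mathcal B)=\mathrm{tr}^l_{m_1,n_1}(\mathcal A)\oplus\mathcal B$ for $\mathcal A\colon l+m_1\to l+n_1$, $\mathcal B\colon m_2\to n_2$; (Yanking) $\mathrm{tr}^m_{m,m}(\mathcal S_{m,m})=\mathcal I_m$; (Naturality1) $\mathrm{tr}^l_{m,n}((\mathcal I_l\oplus\mathcal B);\mathcal A)=\mathcal B;\mathrm{tr}^l_{k,n}(\mathcal A)$ for $\mathcal A\colon l+k\to l+n$, $\mathcal B\colon m\to k$; (Naturality2) $\mathrm{tr}^l_{m,n}(\mathcal A;(\mathcal I_l\oplus\mathcal B))=\mathrm{tr}^l_{m,k}(\mathcal A);\mathcal B$ for $\mathcal A\colon l+m\to l+k$, $\mathcal B\colon k\to n$; (Dinaturality) $\mathrm{tr}^l_{m,n}((\mathcal B\oplus\mathcal I_m);\mathcal A)=\mathrm{tr}^k_{m,n}(\mathcal A;(\mathcal B\oplus\mathcal I_n))$ for $\mathcal A\colon k+m\to l+n$, $\mathcal B\colon l\to k$.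
   Context: Notation: $[k]=\{1,\dots,k\}$, $[a,b]=\{a,\dots,b\}$, $+$ disjoint union. Fix a nonempty finite action set $A$. A rightward open MDP (roMDP) $\mathcal A\colon m\to n$ is $(m,n,Q,A,E,P,R)$: $Q$ finite set of positions; $E\colon[m]\to Q+[n]$ (entrances $[m]$, exits $[n]$); $P\colon Q\times A\times(Q+[n])\to\mathbb R_{\ge0}$ with $\sum_{s'}P(s,a,s')\in\{0,1\}$; $R\colon Q\to\mathbb R_{\ge0}$; unique access: with $\mathrm{exits}(s)=\{t\in[n]\mid\exists a.P(s,a,t)>0\}$ ($s\in Q$), $\mathrm{exits}(i)=\{E(i)\}$ if $E(i)\in[n]$ else $\emptyset$ ($i\in[m]$), distinct elements of $[m]+Q$ have disjoint exit sets, and $P(s,a,t)>0$, $P(s,b,t)>0$, $t\in[n]$ imply $a=b$. Isomorphism of roMDPs $m\to n$: a bijection of position sets (identity on exits) preserving $E,P,R$. Sequential composition $\mathcal A;\mathcal B$ for $\mathcal A\colon m\to k$, $\mathcal B\colon k\to n$: positions $Q^{\mathcal A}+Q^{\mathcal B}$; $E(i)=E^{\mathcal A}(i)$ if in $Q^{\mathcal A}$, else $E^{\mathcal B}(E^{\mathcal A}(i))$; for $s\in Q^{\mathcal A}$, $P(s,a,s')=P^{\mathcal A}(s,a,s')$ if $s'\in Q^{\mathcal A}$ and $\sum_{i\in[k]}P^{\mathcal A}(s,a,i)[E^{\mathcal B}(i)=s']$ if $s'\in Q^{\mathcal B}+[n]$; for $s\in Q^{\mathcal B}$, $P(s,a,s')=P^{\mathcal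 B}(s,a,s')$ if $s'\in Q^{\mathcal B}+[n]$, else $0$; rewards by case distinction. Sum $\mathcal A\oplus\mathcal B\colon m+k\to n+l$ ($\mathcal A\colon m\to n$, $\mathcal B\colon k\to l$): disjoint union with entrances of $\mathcal B$ shifted by $m$ and exits of $\mathcal B$ shifted by $n$. Identity $\mathcal I_m$: no positions, $E(i)=i$. Swap $\mathcal S_{m,n}\colon m+n\to n+m$: no positions, $E(i)=i+n$ ($i\le m$), $E(i)=i-m$ ($i>m$). Trace $\mathrm{tr}^l_{m,n}(\mathcal A)\colon m\to n$ for $\mathcal A\colon l+m\to l+n$: positions $Q^{\mathcal A}$, rewards $R^{\mathcal A}$; exits in $[l]$ are fed back to entrances in $[l]$. For $i\in[m]$: $i_0=i+l$, $i_j=E^{\mathcal A}(i_{j-1})$, $k$ first index with $i_k\in[l+1,l+n]+Q^{\mathcal A}$; $E(i)=i_k-l$ if $i_k$ is an exit, else $i_k$. For $t\in[l+1,l+n]+Q^{\mathcal A}$, $\mathrm{prec}(t)$ is the set of $i\in[l]$ such that the sequence $i_0=i$, $i_{j+1}=E^{\mathcal A}(i_j)$ stays in $[l]$ until it equals $t$. $P(q,a,q')=P^{\mathcal A}(q,a,q'+l)+\sum_{i\in\mathrm{prec}(q'+l)}P^{\mathcal A}(q,a,i)$ if $q'\in[n]$; $P(q,a,q')=P^{\mathcal A}(q,a,q')+\sum_{i\in\mathrm{prec}(q')}P^{\mathcal A}(q,a,i)$ if $q'\in Q^{\mathcal A}$. In $\mathrm{tr}^l$ the traced wires are the first $l$ entrances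 and exits. *)

theory Defs
  imports Complex_Main
begin

(* The fixed nonempty finite action set is the type 'a::finite. Positions form an explicit
   finite carrier inside a type 'q, so that there may be none of them. In 'q + nat the summand
   Inl is a position and Inr is an exit; [k] is {1..k}. Values of the functions outside of the
   carriers are unconstrained and never compared. *)

record ('q, 'a) romdp =
  entrances :: nat
  exit_count :: nat
  positions :: "'q set"
  entry :: "nat \<Rightarrow> 'q + nat"
  prob :: "'q \<Rightarrow> 'a \<Rightarrow> 'q + nat \<Rightarrow> real"
  reward :: "'q \<Rightarrow> real"

definition targets :: "('q, 'a) romdp \<Rightarrow> ('q + nat) set" where
  "targets A = positions A <+> {1..exit_count A}"

(* Here Inl is an entrance and Inr is a position. *)
fun exits :: "('q, 'a) romdp \<Rightarrow> nat + 'q \<Rightarrow> nat set" where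
  "exits A (Inl i) = (case entry A i of Inl q \<Rightarrow> {} | Inr t \<Rightarrow> {t})"
| "exits A (Inr s) = {t \<in> {1..exit_count A}. \<exists>a. prob A s a (Inr t) > 0}"

definition unique_access :: "('q, 'a) romdp \<Rightarrow> bool" where
  "unique_access A \<longleftrightarrow>
     (\<forall>x \<in> {1..entrances A} <+> positions A. \<forall>y \<in> {1..entrances A} <+> positions A.
        x \<noteq> y \<longrightarrow> exits A x \<inter> exits A y = {}) \<and>
     (\<forall>s \<in> positions A. \<forall>t \<in> {1..exit_count A}. \<forall>a b.
        prob A s a (Inr t) > 0 \<and> prob A s b (Inr t) > 0 \<longrightarrow> a = b)"

definition roMDP :: "nat \<Rightarrow> nat \<Rightarrow> ('q, 'a::finite) romdp set" where
  "roMDP m n = {A.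
     entrances A = m \<and> exit_count A = n \<and>
     finite (positions A) \<and>
     (\<forall>i \<in> {1..m}. entry A i \<in> targets A) \<and>
     (\<forall>s \<in> positions A. \<forall>a. \<forall>s' \<in> targets A. prob A s a s' \<ge> 0) \<and>
     (\<forall>s \<in> positions A. \<forall>a. (\<Sum>s' \<in> targets A. prob A s a s') \<in> {0, 1}) \<and>
     (\<forall>s \<in> positions A. reward A s \<ge> 0) \<and>
     unique_access A}"

definition romdp_iso ::
  "('p, 'a::finite) romdp \<Rightarrow> nat \<Rightarrow> nat \<Rightarrow> ('q, 'a) romdp \<Rightarrow> bool"
  ("(_ \<cong>\<^bsub>_,_\<^esub> _)" [51, 0, 0, 51] 50) where
  "A \<cong>\<^bsub>m,n\<^esub> B \<longleftrightarrow> A \<in> roMDP m n \<and> B \<in> roMDP m n \<and>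
     (\<exists>f. bij_betw f (positions A) (positions B) \<and>
        (\<forall>i \<in> {1..m}. entry B i = map_sum f id (entry A i)) \<and>
        (\<forall>s \<in> positions A. \<forall>a. \<forall>s' \<in> targets A.
           prob B (f s) a (map_sum f id s') = prob A s a s') \<and>
        (\<forall>s \<in> positions A. reward B (f s) = reward A s))"

definition seq_comp ::
  "('p, 'a) romdp \<Rightarrow> ('q, 'a) romdp \<Rightarrow> ('p + 'q, 'a) romdp" (infixl "\<Zcomp>" 65) where
  "A \<Zcomp> B = \<lparr>
     entrances = entrances A,
     exit_count = exit_count B,
     positions = positions A <+> positions B,
     entry = (\<lambda>i. case entry A i of
         Inl s \<Rightarrow> Inl (Inl s)
       | Inr j \<Rightarrow> map_sum Inr id (entry B j)),
     prob = (\<lambda>s a s'. case s of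
         Inl p \<Rightarrow> (case s' of
             Inl (Inl p') \<Rightarrow> prob A p a (Inl p')
           | Inl (Inr q') \<Rightarrow>
               (\<Sum>i = 1..exit_count A. prob A p a (Inr i) * of_bool (entry B i = Inl q'))
           | Inr t \<Rightarrow>
               (\<Sum>i = 1..exit_count A. prob A p a (Inr i) * of_bool (entry B i = Inr t)))
       | Inr q \<Rightarrow> (case s' of
             Inl (Inl p') \<Rightarrow> 0
           | Inl (Inr q') \<Rightarrow> prob B q a (Inl q')
           | Inr t \<Rightarrow> prob B q a (Inr t))),
     reward = case_sum (reward A) (reward B) \<rparr>"

definition oplus ::
  "('p, 'a) romdp \<Rightarrow> ('q, 'a) romdp \<Rightarrow> ('p + 'q, 'a) romdp" (infixl "\<oplus>" 65) where
  "A \<oplus> B = \<lparr>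
     entrances = entrances A + entrances B,
     exit_count = exit_count A + exit_count B,
     positions = positions A <+> positions B,
     entry = (\<lambda>i.
       if i \<le> entrances A then map_sum Inl id (entry A i)
       else map_sum Inr (\<lambda>t. t + exit_count A) (entry B (i - entrances A))),
     prob = (\<lambda>s a s'. case s of
         Inl p \<Rightarrow> (case s' of
             Inl (Inl p') \<Rightarrow> prob A p a (Inl p')
           | Inl (Inr q') \<Rightarrow> 0
           | Inr t \<Rightarrow> if t \<le> exit_count A then prob A p a (Inr t) else 0)
       | Inr q \<Rightarrow> (case s' of
             Inl (Inl p') \<Rightarrow> 0
           | Inl (Inr q') \<Rightarrow> prob B q a (Inl q')
           | Inr t \<Rightarrow> if t \<le> exit_count A then 0 else prob B q a (Inr (t - exit_count A)))),
     reward = case_sum (reward A) (reward B) \<rparr>"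

definition ident :: "nat \<Rightarrow> ('q, 'a) romdp" ("\<I>") where
  "\<I> m = \<lparr>
     entrances = m,
     exit_count = m,
     positions = {},
     entry = (\<lambda>i. Inr i),
     prob = (\<lambda>s a s'. 0),
     reward = (\<lambda>s. 0) \<rparr>"

definition swap :: "nat \<Rightarrow> nat \<Rightarrow> ('q, 'a) romdp" ("\<S>") where
  "\<S> m n = \<lparr>
     entrances = m + n,
     exit_count = n + m,
     positions = {},
     entry = (\<lambda>i. if i \<le> m then Inr (i + n) else Inr (i - m)),
     prob = (\<lambda>s a s'. 0),
     reward = (\<lambda>s. 0) \<rparr>"

(* The sequence i_0 = i, i_(j+1) = E(i_j), where an exit is read as the entrance of the same
   number. It is only consulted up to the first index at which it leaves [l]; its value after
   reaching a position is immaterial. *)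
primrec entry_seq :: "('q, 'a) romdp \<Rightarrow> nat \<Rightarrow> nat \<Rightarrow> 'q + nat" where
  "entry_seq A i 0 = Inr i"
| "entry_seq A i (Suc j) = (case entry_seq A i j of Inl q \<Rightarrow> Inl q | Inr x \<Rightarrow> entry A x)"

(* The first index is sought among k > 0: the starting value i + l is an entrance, even though
   its number may lie in [l+1, l+n]. *)
definition trace_entry :: "nat \<Rightarrow> nat \<Rightarrow> ('q, 'a) romdp \<Rightarrow> nat \<Rightarrow> 'q + nat" where
  "trace_entry l n A i =
     (let k = (LEAST k. 0 < k \<and> entry_seq A (i + l) k \<in> positions A <+> {l + 1..l + n})
      in map_sum id (\<lambda>t. t - l) (entry_seq A (i + l) k))"

definition prec :: "nat \<Rightarrow> ('q, 'a) romdp \<Rightarrow> 'q + nat \<Rightarrow> nat set" where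
  "prec l A t = {i \<in> {1..l}. \<exists>k. entry_seq A i k = t \<and> (\<forall>j<k. entry_seq A i j \<in> Inr ` {1..l})}"

definition trace :: "nat \<Rightarrow> nat \<Rightarrow> nat \<Rightarrow> ('q, 'a) romdp \<Rightarrow> ('q, 'a) romdp" where
  "trace l m n A = \<lparr>
     entrances = m,
     exit_count = n,
     positions = positions A,
     entry = trace_entry l n A,
     prob = (\<lambda>q a s'. case s' of
         Inl q' \<Rightarrow> prob A q a (Inl q') + (\<Sum>i \<in> prec l A (Inl q'). prob A q a (Inr i))
       | Inr t \<Rightarrow> prob A q a (Inr (t + l)) + (\<Sum>i \<in> prec l A (Inr (t + l)). prob A q a (Inr i))),
     reward = reward A \<rparr>"

end

theory Submission
  imports Defs
begin

text \<open>
  Call the entrances and the pairs of a position and an action the sources of a system. Each source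
  carries a weight on the targets, a point mass in the case of an entrance. All operations push these
  weights forward: sequential composition and sum along functions, the trace along the partial
  function that follows a wire through the feedback loop until it leaves it. Push-forwards compose,
  so each equation becomes an identity between partial functions on targets.
  Unique access makes the trace well-defined: feedback is injective on wires, hence it permutes the
  wires that never leave the loop, and neither an untraced entrance nor a transition can lead to one
  of them.
\<close>


subsection \<open>Push-forwards\<close>

text \<open>An equation is checked by writing the weights of corresponding sources of both sides as
  push-forwards of one weight on one finite set. Then only two relations have to be compared, and no
  sum is manipulated again. The push-forwards run along relations since a wire that circles forever
  has no destination. Weight on such a wire would be lost: the sums over targets could fall strictly
  between 0 and 1, and the first index in the definition of a traced entry would not exist. So the
  trace needs unique access twice, to show that nothing is lost and that paths of different sources
  do not merge before the same exit. The trace equations rest on three comparisons of loops: a loop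
  whose targets are renamed or sent on (Superposing and both naturalities), a loop nested in another
  one (Vanishing2), and one loop cut at two different places (Dinaturality). Each comparison is an
  equivalence: one side has a destination exactly if the other has the corresponding one.\<close>

definition push :: "'u set \<Rightarrow> ('u \<Rightarrow> 'v \<Rightarrow> bool) \<Rightarrow> ('u \<Rightarrow> real) \<Rightarrow> 'v \<Rightarrow> real" where
  "push D R w t = (\<Sum>u\<in>D. w u * of_bool (R u t))"

text \<open>A partial function from \<open>D\<close> to \<open>T\<close>. It is constrained on
  \<open>D\<close> only, because the data of a system are arbitrary outside of the carriers.\<close>

definition wiring :: "'u set \<Rightarrow> 'v set \<Rightarrow> ('u \<Rightarrow> 'v \<Rightarrow> bool) \<Rightarrow> bool" where
  "wiring D T R \<longleftrightarrow> finite D \<and> finite T \<and>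
     (\<forall>u\<in>D. \<forall>v. R u v \<longrightarrow> v \<in> T) \<and> (\<forall>u\<in>D. \<forall>v v'. R u v \<longrightarrow> R u v' \<longrightarrow> v = v')"

lemma push_cong:
  assumes "\<And>u. u \<in> D \<Longrightarrow> R u t \<longleftrightarrow> R' u t'"
  shows "push D R w t = push D R' w t'"
  using assms by (simp add: push_def)

lemma push_delta:
  assumes "finite D" "e \<in> D"
  shows "push D R (\<lambda>u. of_bool (e = u)) t = of_bool (R e t)"
proof -
  have "push D R (\<lambda>u. of_bool (e = u)) t = (\<Sum>u\<in>D. if u = e then of_bool (R e t) else 0)"
    unfolding push_def by (rule sum.cong) auto
  then show ?thesis using assms by simp
qed

lemma push_eq_point:
  assumes "finite D" "e \<in> D" "\<And>u. u \<in> D \<Longrightarrow> R u t \<longleftrightarrow> u = e"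
  shows "push D R w t = w e"
proof -
  have "push D R w t = (\<Sum>u\<in>D. if u = e then w e else 0)"
    unfolding push_def using assms(3) by (intro sum.cong) auto
  then show ?thesis using assms by simp
qed

lemma push_eq_0:
  assumes "\<And>u. u \<in> D \<Longrightarrow> \<not> R u t"
  shows "push D R w t = 0"
  using assms by (simp add: push_def)

lemma push_nonneg:
  assumes "\<And>u. u \<in> D \<Longrightarrow> w u \<ge> 0"
  shows "push D R w t \<ge> 0"
  unfolding push_def using assms by (intro sum_nonneg) simp

lemma push_posD:
  assumes "push D R w t > 0"
  obtains u where "u \<in> D" "R u t" "w u > 0"
proof -
  have "\<not> (\<forall>u\<in>D. w u * of_bool (R u t) \<le> 0)"
    using assms sum_nonpos[of D "\<lambda>u. w u * of_bool (R u t)"] unfolding push_def by force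
  then obtain u where "u \<in> D" "w u * of_bool (R u t) > 0" by force
  with that show thesis by (cases "R u t") auto
qed

text \<open>Functoriality. After exchanging the sums, the inner sum of the products of indicators
  has at most one nonzero term, as \<open>R\<close> is single-valued on \<open>D\<close>; hence it
  is the indicator of \<open>R OO R'\<close>.\<close>

lemma push_push:
  assumes wir: "wiring D T R" and w': "\<And>v. v \<in> T \<Longrightarrow> w' v = push D R w v"
  shows "push T R' w' t = push D (R OO R') w t"
proof -
  have fin: "finite D" "finite T" using wir by (auto simp: wiring_def)
  have *: "(\<Sum>v\<in>T. of_bool (R u v) * of_bool (R' v t)) = (of_bool ((R OO R') u t) :: real)"
    if "u \<in> D" for u
  proof (cases "\<exists>v. R u v")
    case True
    then obtain v where v: "R u v" by blast
    have un: "v' = v" if "R u v'" for v' using v that \<open>u \<in> D\<close> wir by (auto simp: wiring_def)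
    have "v \<in> T" using v \<open>u \<in> D\<close> wir by (auto simp: wiring_def)
    have "(\<Sum>v\<in>T. of_bool (R u v) * of_bool (R' v t))
        = (\<Sum>v'\<in>T. if v' = v then of_bool (R' v t) else (0::real))"
      using v by (intro sum.cong) (auto dest: un)
    also have "\<dots> = of_bool (R' v t)" using \<open>v \<in> T\<close> fin by simp
    also have "R' v t \<longleftrightarrow> (R OO R') u t" using v by (auto dest: un)
    finally show ?thesis .
  qed auto
  have "push T R' w' t = (\<Sum>v\<in>T. \<Sum>u\<in>D. w u * (of_bool (R u v) * of_bool (R' v t)))"
    unfolding push_def
    by (intro sum.cong) (simp_all add: w' push_def sum_distrib_right mult.assoc)
  also have "\<dots> = (\<Sum>u\<in>D. w u * (\<Sum>v\<in>T. of_bool (R u v) * of_bool (R' v t)))"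
    by (subst sum.swap) (simp add: sum_distrib_left)
  also have "\<dots> = push D (R OO R') w t"
    unfolding push_def by (intro sum.cong) (simp_all add: *)
  finally show ?thesis .
qed

text \<open>The total mass is the push-forward to a one-point set. Composing \<open>R\<close> with
  the constantly true relation leaves the indicator of the domain of \<open>R\<close>, which is 1
  wherever \<open>w\<close> is nonzero.\<close>

lemma sum_push:
  assumes wir: "wiring D T R" and total: "\<And>u. u \<in> D \<Longrightarrow> w u \<noteq> 0 \<Longrightarrow> \<exists>v. R u v"
  shows "(\<Sum>t\<in>T. push D R w t) = (\<Sum>u\<in>D. w u)"
proof -
  have "(\<Sum>t\<in>T. push D R w t) = push T (\<lambda>_ _. True) (push D R w) ()"
    by (simp add: push_def)
  also have "\<dots> = push D (R OO (\<lambda>_ _. True)) w ()"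
    by (rule push_push[OF wir]) simp
  also have "\<dots> = (\<Sum>u\<in>D. w u)"
    unfolding push_def using total by (intro sum.cong) auto
  finally show ?thesis .
qed

lemma wiring_fun:
  assumes "finite D" "finite T" "\<And>u. u \<in> D \<Longrightarrow> g u \<in> T"
  shows "wiring D T (\<lambda>u v. v = g u)"
  using assms by (auto simp: wiring_def)

lemma wiring_OO: "wiring D T R \<Longrightarrow> wiring T T' R' \<Longrightarrow> wiring D T' (R OO R')"
  unfolding wiring_def by blast

subsection \<open>Sources and weights\<close>

fun weight :: "('q, 'a) romdp \<Rightarrow> nat + 'q \<times> 'a \<Rightarrow> 'q + nat \<Rightarrow> real" where
  "weight A (Inl i) u = of_bool (entry A i = u)"
| "weight A (Inr (s, a)) u = prob A s a u"

definition sources :: "('q, 'a) romdp \<Rightarrow> (nat + 'q \<times> 'a) set" where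
  "sources A = {1..entrances A} <+> positions A \<times> UNIV"

lemma weight_Inl: "weight A (Inl i) = (\<lambda>u. of_bool (entry A i = u))"
  by (rule ext) simp

lemma targets_simps [simp]:
  "Inl q \<in> targets A \<longleftrightarrow> q \<in> positions A"
  "Inr t \<in> targets A \<longleftrightarrow> 1 \<le> t \<and> t \<le> exit_count A"
  by (auto simp: targets_def)

lemma sources_simps [simp]:
  "Inl i \<in> sources A \<longleftrightarrow> 1 \<le> i \<and> i \<le> entrances A"
  "Inr y \<in> sources A \<longleftrightarrow> fst y \<in> positions A"
  by (auto simp: sources_def mem_Times_iff)

lemma roMDP_D:
  assumes "A \<in> roMDP m n"
  shows "entrances A = m" "exit_count A = n" "finite (positions A)" "finite (targets A)"
    "1 \<le> i \<Longrightarrow> i \<le> m \<Longrightarrow> entry A i \<in> targets A"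
    "s \<in> positions A \<Longrightarrow> reward A s \<ge> 0"
  using assms by (auto simp: roMDP_def targets_def)

text \<open>The two clauses of unique access merge: disjoint exit sets identify the entrance or
  position, and the second clause identifies the action. The assumption is there because
  \<open>exits A (Inl i)\<close>, in contrast to the exit set of a position, is not cut down to the
  range of exits.\<close>

lemma unique_access_iff:
  assumes "\<And>i. 1 \<le> i \<Longrightarrow> i \<le> entrances A \<Longrightarrow> entry A i \<in> targets A"
  shows "unique_access A \<longleftrightarrow> (\<forall>x\<in>sources A. \<forall>y\<in>sources A. \<forall>t\<in>{1..exit_count A}.
           weight A x (Inr t) > 0 \<longrightarrow> weight A y (Inr t) > 0 \<longrightarrow> x = y)" (is "_ \<longleftrightarrow> ?R")
proof
  assume u: "unique_access A"
  define origin :: "nat + 'a \<times> 'b \<Rightarrow> nat + 'a" where "origin = map_sum id fst"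
  show ?R
  proof (intro ballI impI)
    fix x y t
    assume x: "x \<in> sources A" and y: "y \<in> sources A" and t: "t \<in> {1..exit_count A}"
      and wx: "weight A x (Inr t) > 0" and wy: "weight A y (Inr t) > 0"
    have ex: "t \<in> exits A (origin z)" if "weight A z (Inr t) > 0" for z
      using that t by (cases z) (auto simp: origin_def split: sum.splits if_splits)
    have mem: "origin z \<in> {1..entrances A} <+> positions A" if "z \<in> sources A" for z
      using that by (cases z) (auto simp: origin_def)
    have eq: "origin x = origin y"
      using conjunct1[OF u[unfolded unique_access_def], rule_format, OF mem[OF x] mem[OF y]]
        ex[OF wx] ex[OF wy] by blast
    show "x = y"
    proof (cases x)
      case (Inl i)
      with eq show ?thesis by (cases y) (auto simp: origin_def)
    next
      case (Inr p)
      with eq obtain s a b where "x = Inr (s, a)" "y = Inr (s, b)"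
        by (cases y; cases p) (auto simp: origin_def)
      with u x t wx wy show ?thesis unfolding unique_access_def by auto
    qed
  qed
next
  assume R: ?R
  have disj: "exits A x \<inter> exits A y = {}"
    if that: "x \<in> {1..entrances A} <+> positions A" "y \<in> {1..entrances A} <+> positions A" "x \<noteq> y"
    for x y
  proof (rule ccontr)
    assume "exits A x \<inter> exits A y \<noteq> {}"
    then obtain t where t: "t \<in> exits A x" "t \<in> exits A y" by blast
    have ex: "t \<in> {1..exit_count A} \<and>
        (\<exists>z'\<in>sources A. map_sum id fst z' = z \<and> weight A z' (Inr t) > 0)"
      if z: "z \<in> {1..entrances A} <+> positions A" "t \<in> exits A z" for z
    proof (cases z)
      case (Inl i)
      then show ?thesis using z assms[of i]
        by (auto split: sum.splits intro!: bexI[of _ "Inl i"])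
    next
      case (Inr s)
      then obtain a where "prob A s a (Inr t) > 0" "t \<in> {1..exit_count A}" using z by auto
      then show ?thesis using Inr z by (auto intro!: bexI[of _ "Inr (s, a)"])
    qed
    note ex_x = ex[OF that(1) t(1)] and ex_y = ex[OF that(2) t(2)]
    obtain x' y' where "x' \<in> sources A" "map_sum id fst x' = x" "weight A x' (Inr t) > 0"
        "y' \<in> sources A" "map_sum id fst y' = y" "weight A y' (Inr t) > 0" "t \<in> {1..exit_count A}"
      using ex_x ex_y by blast
    then show False using R[rule_format, of x' y' t] that(3) by auto
  qed
  have "a = b" if "s \<in> positions A" "t \<in> {1..exit_count A}"
      "prob A s a (Inr t) > 0" "prob A s b (Inr t) > 0" for s t a b
    using R[rule_format, of "Inr (s, a)" "Inr (s, b)" t] that by simp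
  with disj show "unique_access A" unfolding unique_access_def by blast
qed

text \<open>Lets closure under an operation be checked uniformly for all sources. Entrances satisfy
  the conditions on weights automatically, since a point mass on a target has total 1.\<close>

lemma roMDP_iff_weight:
  fixes A :: "('q, 'a::finite) romdp"
  shows "A \<in> roMDP m n \<longleftrightarrow>
     entrances A = m \<and> exit_count A = n \<and> finite (positions A) \<and>
     (\<forall>i\<in>{1..m}. entry A i \<in> targets A) \<and> (\<forall>s\<in>positions A. reward A s \<ge> 0) \<and>
     (\<forall>x\<in>sources A. (\<forall>u\<in>targets A. weight A x u \<ge> 0) \<and> (\<Sum>u\<in>targets A. weight A x u) \<in> {0, 1}) \<and>
     (\<forall>x\<in>sources A. \<forall>y\<in>sources A. \<forall>t\<in>{1..n}.
        weight A x (Inr t) > 0 \<longrightarrow> weight A y (Inr t) > 0 \<longrightarrow> x = y)" (is "?L \<longleftrightarrow> ?R")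
proof
  assume L: ?L
  then have fin: "finite (targets A)" by (rule roMDP_D)
  have w: "(\<forall>u\<in>targets A. weight A x u \<ge> 0) \<and> (\<Sum>u\<in>targets A. weight A x u) \<in> {0, 1}"
    if "x \<in> sources A" for x
  proof (cases x)
    case (Inl i)
    then have "entry A i \<in> targets A" using that L by (auto simp: roMDP_def)
    then have "(\<Sum>u\<in>targets A. weight A x u) = 1"
      using Inl push_delta[OF fin, of "entry A i" "\<lambda>_ _. True" "()"] by (simp add: push_def)
    then show ?thesis using Inl by simp
  next
    case (Inr y)
    then show ?thesis using that L by (cases y) (auto simp: roMDP_def)
  qed
  have ua: "unique_access A" and
    ent: "1 \<le> i \<Longrightarrow> i \<le> entrances A \<Longrightarrow> entry A i \<in> targets A" for i
    using L by (auto simp: roMDP_def)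
  have "\<forall>x\<in>sources A. \<forall>y\<in>sources A. \<forall>t\<in>{1..exit_count A}.
      weight A x (Inr t) > 0 \<longrightarrow> weight A y (Inr t) > 0 \<longrightarrow> x = y"
    by (rule iffD1[OF unique_access_iff ua]) (rule ent)
  then show ?R using w L unfolding roMDP_def by blast
next
  assume R: ?R
  then have "unique_access A" by (subst unique_access_iff) simp_all
  moreover have "(\<forall>s'\<in>targets A. prob A s a s' \<ge> 0) \<and> (\<Sum>s'\<in>targets A. prob A s a s') \<in> {0, 1}"
    if "s \<in> positions A" for s a
  proof -
    have "Inr (s, a) \<in> sources A" using that by simp
    with R have "(\<forall>u\<in>targets A. weight A (Inr (s, a)) u \<ge> 0) \<and>
        (\<Sum>u\<in>targets A. weight A (Inr (s, a)) u) \<in> {0, 1}" by blast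
    then show ?thesis by simp
  qed
  ultimately show ?L using R unfolding roMDP_def by simp
qed

lemma roMDP_weight_nonneg:
  "A \<in> roMDP m n \<Longrightarrow> x \<in> sources A \<Longrightarrow> u \<in> targets A \<Longrightarrow> weight A x u \<ge> 0"
  by (simp add: roMDP_iff_weight)

lemma roMDP_weight_sum:
  "A \<in> roMDP m n \<Longrightarrow> x \<in> sources A \<Longrightarrow> (\<Sum>u\<in>targets A. weight A x u) \<in> {0, 1}"
  by (simp add: roMDP_iff_weight)

lemma roMDP_unique:
  assumes "A \<in> roMDP m n" "x \<in> sources A" "y \<in> sources A" "Inr t \<in> targets A"
    "weight A x (Inr t) > 0" "weight A y (Inr t) > 0"
  shows "x = y"
  using assms(1)[unfolded roMDP_iff_weight] assms(2-) by simp

text \<open>The injectivity that feedback relies on. It concerns exits only; several entrances may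
  lead to the same position.\<close>

lemma roMDP_entry_inj:
  assumes "A \<in> roMDP m n" "i \<in> {1..m}" "j \<in> {1..m}" "entry A i = Inr t" "entry A j = Inr t"
  shows "i = j"
proof -
  have "Inr t \<in> targets A" using roMDP_D(5)[OF assms(1), of i] assms by auto
  then show ?thesis using roMDP_unique[OF assms(1), of "Inl i" "Inl j" t] assms roMDP_D(1)[OF assms(1)]
    by auto
qed

lemma roMDP_I:
  fixes G :: "('q, 'a::finite) romdp"
  assumes "entrances G = m" "exit_count G = n" "finite (positions G)"
    and "\<And>i. i \<in> {1..m} \<Longrightarrow> entry G i \<in> targets G"
    and "\<And>s. s \<in> positions G \<Longrightarrow> reward G s \<ge> 0"
    and "\<And>x u. x \<in> sources G \<Longrightarrow> u \<in> targets G \<Longrightarrow> weight G x u \<ge> 0"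
    and "\<And>x. x \<in> sources G \<Longrightarrow> (\<Sum>u\<in>targets G. weight G x u) \<in> {0, 1}"
    and "\<And>x y t. x \<in> sources G \<Longrightarrow> y \<in> sources G \<Longrightarrow> t \<in> {1..n} \<Longrightarrow>
        weight G x (Inr t) > 0 \<Longrightarrow> weight G y (Inr t) > 0 \<Longrightarrow> x = y"
  shows "G \<in> roMDP m n"
  unfolding roMDP_iff_weight using assms by blast

text \<open>The base \<open>D\<close> is left open so that two sources of different systems can be
  given the same base and the same weight \<open>w\<close> on it.\<close>

definition flow :: "('q, 'a) romdp \<Rightarrow> nat + 'q \<times> 'a \<Rightarrow> 'u set \<Rightarrow> ('u \<Rightarrow> 'q + nat \<Rightarrow> bool) \<Rightarrow>
    ('u \<Rightarrow> real) \<Rightarrow> bool" where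
  "flow A x D R w \<longleftrightarrow> wiring D (targets A) R \<and> (\<forall>t\<in>targets A. weight A x t = push D R w t)"

lemma flow_refl:
  assumes "A \<in> roMDP m n"
  shows "flow A x (targets A) (=) (weight A x)"
  using roMDP_D(4)[OF assms] push_eq_point[of "targets A" _ "(=)"] unfolding flow_def
  by (auto simp: wiring_def)

text \<open>A unit mass on a one-point set is a common base for entrances of any two
  systems.\<close>

lemma flow_entry:
  assumes "A \<in> roMDP m n" "i \<in> {1..m}"
  shows "flow A (Inl i) {()} (\<lambda>_ t. t = entry A i) (\<lambda>_. 1)"
  using assms roMDP_D(4,5)[OF assms(1)] by (auto simp: flow_def wiring_def push_def)

text \<open>The second premise has the shape in which every operation is described, with the weights
  of a component as base. Nested operations thus turn into composites of relations over the
  innermost base.\<close>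

lemma flow_trans:
  assumes "flow A x D R w" "flow G y (targets A) R' (weight A x)"
  shows "flow G y D (R OO R') w"
  using assms push_push[of D "targets A" R "weight A x" w R'] wiring_OO[of D "targets A" R "targets G" R']
  unfolding flow_def by simp

text \<open>A destination is required only for targets of positive weight. For composition and sum
  \<open>R\<close> is a function and this is immediate; for the trace it is
  \<open>source_resolves\<close>.\<close>

lemma flow_nonneg_sum:
  assumes A: "A \<in> roMDP m n" "x \<in> sources A" and fl: "flow G y (targets A) R (weight A x)"
    and total: "\<And>u. u \<in> targets A \<Longrightarrow> weight A x u > 0 \<Longrightarrow> \<exists>v. R u v"
  shows "u \<in> targets G \<Longrightarrow> weight G y u \<ge> 0"
    and "(\<Sum>u\<in>targets G. weight G y u) \<in> {0, 1}"
proof -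
  note nn = roMDP_weight_nonneg[OF A]
  show "u \<in> targets G \<Longrightarrow> weight G y u \<ge> 0"
    using fl push_nonneg[OF nn] by (auto simp: flow_def)
  have "(\<Sum>u\<in>targets G. weight G y u) = (\<Sum>u\<in>targets G. push (targets A) R (weight A x) u)"
    using fl by (intro sum.cong) (auto simp: flow_def)
  also have "\<dots> = (\<Sum>u\<in>targets A. weight A x u)"
    using fl nn total by (intro sum_push) (auto simp: flow_def less_le)
  finally show "(\<Sum>u\<in>targets G. weight G y u) \<in> {0, 1}" using roMDP_weight_sum[OF A] by simp
qed

lemma flow_posD:
  assumes "flow G y D R w" "t \<in> targets G" "weight G y t > 0"
  obtains u where "u \<in> D" "R u t" "w u > 0"
proof -
  have "push D R w t > 0" using assms(1)[unfolded flow_def] assms(2,3) by simp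
  then show thesis by (rule push_posD) (rule that)
qed

section \<open>A criterion for isomorphism in terms of weights\<close>

text \<open>That the image is a target of \<open>B\<close> is a premise here, so that a single
  source can be treated without regard to the range of \<open>f\<close>; \<open>romdp_isoI\<close>
  supplies it from the bijection.\<close>

definition same_weight :: "('p, 'a) romdp \<Rightarrow> nat + 'p \<times> 'a \<Rightarrow> ('q, 'a) romdp \<Rightarrow> nat + 'q \<times> 'a \<Rightarrow>
    ('p \<Rightarrow> 'q) \<Rightarrow> bool" where
  "same_weight A x B y f \<longleftrightarrow>
     (\<forall>t. t \<in> targets A \<longrightarrow> map_sum f id t \<in> targets B \<longrightarrow> weight B y (map_sum f id t) = weight A x t)"

lemma same_weight_flowI:
  assumes "flow A x D R w" "flow B y D R' w"
    and "\<And>u t. u \<in> D \<Longrightarrow> t \<in> targets A \<Longrightarrow> R u t \<longleftrightarrow> R' u (map_sum f id t)"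
  shows "same_weight A x B y f"
proof -
  have "push D R w t = push D R' w (map_sum f id t)" if "t \<in> targets A" for t
    using assms(3) that by (intro push_cong)
  then show ?thesis
    using assms(1)[unfolded flow_def] assms(2)[unfolded flow_def] by (simp add: same_weight_def)
qed

lemma romdp_isoI:
  fixes f :: "'p \<Rightarrow> 'q"
  assumes A: "A \<in> roMDP m n" and B: "B \<in> roMDP m n"
    and f: "bij_betw f (positions A) (positions B)"
    and rew: "\<And>s. s \<in> positions A \<Longrightarrow> reward B (f s) = reward A s"
    and same: "\<And>x. x \<in> sources A \<Longrightarrow> same_weight A x B (map_sum id (map_prod f id) x) f"
  shows "A \<cong>\<^bsub>m,n\<^esub> B"
proof -
  have "map_sum f id t \<in> targets B" if "t \<in> targets A" for t
    using that f roMDP_D(2)[OF A] roMDP_D(2)[OF B] by (cases t) (auto simp: bij_betw_def)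
  then have w: "weight B (map_sum id (map_prod f id) x) (map_sum f id t) = weight A x t"
    if "x \<in> sources A" "t \<in> targets A" for x t
    using same that unfolding same_weight_def by blast
  \<comment> \<open>Equal point masses sit at the same place: evaluated at \<open>entry A i\<close>
    the weight is 1, hence also on the other side.\<close>
  have "entry B i = map_sum f id (entry A i)" if "i \<in> {1..m}" for i
    using w[of "Inl i" "entry A i"] roMDP_D(1,5)[OF A] that by (auto split: if_splits)
  moreover have "prob B (f s) a (map_sum f id t) = prob A s a t"
    if "s \<in> positions A" "t \<in> targets A" for s a t
    using w[of "Inr (s, a)" t] that by simp
  ultimately show ?thesis using assms(1-4) unfolding romdp_iso_def by blast
qed

subsection \<open>Sequential composition and sum\<close>

definition lift_left :: "nat + 'p \<times> 'a \<Rightarrow> nat + ('p + 'q) \<times> 'a" where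
  "lift_left = map_sum id (map_prod Inl id)"

definition lift_right :: "nat \<Rightarrow> nat + 'q \<times> 'a \<Rightarrow> nat + ('p + 'q) \<times> 'a" where
  "lift_right k = map_sum (\<lambda>i. i + k) (map_prod Inr id)"

lemma lift_simps [simp]:
  "lift_left (Inl i) = Inl i" "lift_left (Inr (p, a)) = Inr (Inl p, a)"
  "lift_right k (Inl i) = Inl (i + k)" "lift_right k (Inr (q, a)) = Inr (Inr q, a)"
  by (simp_all add: lift_left_def lift_right_def)

lemma lift_left_eq_iff [simp]: "lift_left x = lift_left y \<longleftrightarrow> x = y"
  by (cases x; cases y) (auto simp: lift_left_def)

fun then_entry :: "('q, 'a) romdp \<Rightarrow> 'p + nat \<Rightarrow> ('p + 'q) + nat" where
  "then_entry B (Inl p) = Inl (Inl p)"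
| "then_entry B (Inr j) = map_sum Inr id (entry B j)"

lemma seq_comp_simps [simp]:
  "entrances (A \<Zcomp> B) = entrances A" "exit_count (A \<Zcomp> B) = exit_count B"
  "positions (A \<Zcomp> B) = positions A <+> positions B"
  "reward (A \<Zcomp> B) = case_sum (reward A) (reward B)"
  "entry (A \<Zcomp> B) i = then_entry B (entry A i)"
  by (auto simp: seq_comp_def split: sum.splits)

lemma oplus_simps [simp]:
  "entrances (A \<oplus> B) = entrances A + entrances B"
  "exit_count (A \<oplus> B) = exit_count A + exit_count B"
  "positions (A \<oplus> B) = positions A <+> positions B"
  "reward (A \<oplus> B) = case_sum (reward A) (reward B)"
  "i \<le> entrances A \<Longrightarrow> entry (A \<oplus> B) i = map_sum Inl id (entry A i)"
  "1 \<le> i \<Longrightarrow> entry (A \<oplus> B) (i + entrances A) = map_sum Inr (\<lambda>t. t + exit_count A) (entry B i)"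
  by (auto simp: oplus_def)

lemma ident_simps [simp]:
  "entrances (\<I> m) = m" "exit_count (\<I> m) = m" "positions (\<I> m) = {}" "entry (\<I> m) i = Inr i"
  by (simp_all add: ident_def)

lemma swap_simps [simp]:
  "entrances (\<S> m n) = m + n" "exit_count (\<S> m n) = n + m" "positions (\<S> m n) = {}"
  "entry (\<S> m n) i = (if i \<le> m then Inr (i + n) else Inr (i - m))"
  by (simp_all add: swap_def)

lemma roMDP_no_positions:
  fixes A :: "('q, 'a::finite) romdp"
  assumes "entrances A = m" "exit_count A = n" "positions A = {}"
    and entry: "\<And>i. i \<in> {1..m} \<Longrightarrow> entry A i = Inr (g i)" "\<And>i. i \<in> {1..m} \<Longrightarrow> g i \<in> {1..n}"
    and inj: "inj_on g {1..m}"
  shows "A \<in> roMDP m n"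
proof -
  have ent: "entry A i \<in> targets A" if "1 \<le> i" "i \<le> entrances A" for i
    using entry[of i] that assms(1,2) by simp
  have "unique_access A"
  proof (subst unique_access_iff, rule ent)
    have "x = y" if that: "x \<in> sources A" "y \<in> sources A"
        "weight A x (Inr t) > 0" "weight A y (Inr t) > 0" for x y t
    proof -
      note xy = that
      obtain i j where ij: "x = Inl i" "y = Inl j" "i \<in> {1..m}" "j \<in> {1..m}"
        using xy(1,2) assms(1,3) by (cases x; cases y) auto
      then have "g i = t" "g j = t"
        using xy(3,4) entry(1)[of i] entry(1)[of j] by (simp_all split: if_splits)
      then show ?thesis using ij inj_onD[OF inj, of i j] by simp
    qed
    then show "\<forall>x\<in>sources A. \<forall>y\<in>sources A. \<forall>t\<in>{1..exit_count A}.
        0 < weight A x (Inr t) \<longrightarrow> 0 < weight A y (Inr t) \<longrightarrow> x = y" by blast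
  qed
  with ent assms(1-3) show ?thesis by (simp add: roMDP_def)
qed

lemma ident_roMDP: "(\<I> m :: ('q, 'a::finite) romdp) \<in> roMDP m m"
  by (rule roMDP_no_positions[where g = "\<lambda>i. i"]) auto

lemma swap_roMDP: "(\<S> m n :: ('q, 'a::finite) romdp) \<in> roMDP (m + n) (n + m)"
  by (rule roMDP_no_positions[where g = "\<lambda>i. if i \<le> m then i + n else i - m"])
    (auto simp: inj_on_def split: if_splits)

text \<open>The entrances of \<open>B\<close> are no sources of the composite; they are absorbed by
  \<open>then_entry\<close>, which continues the exits of \<open>A\<close> into
  \<open>B\<close>.\<close>

lemma sources_seq_comp_cases [consumes 1, case_names left right]:
  assumes "y \<in> sources (A \<Zcomp> B)"
  obtains x where "x \<in> sources A" "y = lift_left x"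
    | q a where "q \<in> positions B" "y = Inr (Inr q, a)"
proof (cases y)
  case (Inl i)
  then show thesis using assms that(1)[of "Inl i"] by simp
next
  case (Inr z)
  obtain s a where z: "z = (s, a)" by (cases z)
  show thesis
  proof (cases s)
    case (Inl p)
    then show thesis using Inr assms that(1)[of "Inr (p, a)"] by (auto simp: z)
  qed (use Inr assms that(2) z in auto)
qed

context
  fixes A :: "('p, 'a::finite) romdp" and B :: "('q, 'a) romdp" and m k n :: nat
  assumes A: "A \<in> roMDP m k" and B: "B \<in> roMDP k n"
begin

lemma then_entry_targets: "u \<in> targets A \<Longrightarrow> then_entry B u \<in> targets (A \<Zcomp> B)"
proof (cases u)
  case (Inr j)
  assume "u \<in> targets A"
  with Inr have "entry B j \<in> targets B" using roMDP_D(2)[OF A] roMDP_D(5)[OF B] by simp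
  with Inr show ?thesis by (cases "entry B j") auto
qed auto

lemma weight_flow_seq_comp_left:
  assumes x: "x \<in> sources A"
  shows "flow (A \<Zcomp> B) (lift_left x) (targets A) (\<lambda>u v. v = then_entry B u) (weight A x)"
proof -
  note fin = roMDP_D(3,4)[OF A]
  have "finite (targets (A \<Zcomp> B))" using roMDP_D(3)[OF A] roMDP_D(3)[OF B] by (simp add: targets_def)
  then have "wiring (targets A) (targets (A \<Zcomp> B)) (\<lambda>u v. v = then_entry B u)"
    using fin then_entry_targets by (intro wiring_fun)
  moreover have "weight (A \<Zcomp> B) (lift_left x) t = push (targets A) (\<lambda>u v. v = then_entry B u) (weight A x) t"
    if t: "t \<in> targets (A \<Zcomp> B)" for t
  proof (cases x)
    case (Inl i)
    then have "entry A i \<in> targets A" using x roMDP_D(1,5)[OF A] by simp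
    then show ?thesis using Inl fin(2) by (simp add: weight_Inl push_delta eq_commute[of t])
  next
    case (Inr y)
    then obtain p a where pa: "x = Inr (p, a)" by (cases y) auto
    \<comment> \<open>The composite is defined by sums over the exits of \<open>A\<close> alone. For
      an exit or a position of \<open>B\<close> the first sum vanishes, which leaves the defining
      formula.\<close>
    have split: "push (targets A) (\<lambda>u v. v = then_entry B u) (weight A x) t
        = (\<Sum>p'\<in>positions A. prob A p a (Inl p') * of_bool (t = Inl (Inl p')))
        + (\<Sum>i = 1..k. prob A p a (Inr i) * of_bool (t = map_sum Inr id (entry B i)))"
      unfolding push_def targets_def roMDP_D(2)[OF A]
      by (subst sum.Plus) (use fin in \<open>simp_all add: pa comp_def\<close>)
    show ?thesis
    proof (cases t)
      case (Inr j)
      then have "t = map_sum Inr id v \<longleftrightarrow> v = Inr j" for v :: "'q + nat" by (cases v) auto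
      then show ?thesis using Inr unfolding split
        by (simp add: pa seq_comp_def roMDP_D(2)[OF A])
    next
      case (Inl s)
      show ?thesis
      proof (cases s)
        case p': (Inl p')
        have "t = then_entry B u \<longleftrightarrow> u = Inl p'" for u :: "'p + nat"
        proof (cases u)
          case (Inr j)
          then show ?thesis by (cases "entry B j") (auto simp: \<open>t = Inl s\<close> p')
        qed (auto simp: Inl p')
        moreover have "Inl p' \<in> targets A" using Inl p' t by auto
        ultimately have "push (targets A) (\<lambda>u v. v = then_entry B u) (weight A x) t = weight A x (Inl p')"
          using fin(2) by (intro push_eq_point)
        then show ?thesis using Inl p' by (simp add: pa seq_comp_def)
      next
        case q': (Inr q')
        have "t = map_sum Inr id v \<longleftrightarrow> v = Inl q'" for v :: "'q + nat"
          by (cases v) (auto simp: Inl q')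
        then show ?thesis unfolding split
          by (simp add: pa Inl q' seq_comp_def roMDP_D(2)[OF A])
      qed
    qed
  qed
  ultimately show ?thesis by (simp add: flow_def)
qed

lemma weight_flow_seq_comp_right:
  assumes q: "q \<in> positions B"
  shows "flow (A \<Zcomp> B) (Inr (Inr q, a)) (targets B) (\<lambda>u v. v = map_sum Inr id u)
    (weight B (Inr (q, a)))"
proof -
  note fin = roMDP_D(3,4)[OF B]
  have "finite (targets (A \<Zcomp> B))" using roMDP_D(3)[OF A] roMDP_D(3)[OF B] by (simp add: targets_def)
  moreover have "map_sum Inr id u \<in> targets (A \<Zcomp> B)" if "u \<in> targets B" for u
    using that by (cases u) auto
  ultimately have "wiring (targets B) (targets (A \<Zcomp> B)) (\<lambda>u v. v = map_sum Inr id u)"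
    using fin by (intro wiring_fun)
  moreover have "weight (A \<Zcomp> B) (Inr (Inr q, a)) t
      = push (targets B) (\<lambda>u v. v = map_sum Inr id u) (weight B (Inr (q, a))) t"
    if t: "t \<in> targets (A \<Zcomp> B)" for t
  proof (cases "\<exists>e. t = map_sum Inr id e")
    case True
    then obtain e :: "'q + nat" where e: "t = map_sum Inr id e" by blast
    have "t = map_sum Inr id u \<longleftrightarrow> u = e" for u :: "'q + nat" using e by (cases u; cases e) auto
    moreover have "e \<in> targets B" using t e by (cases e) auto
    ultimately show ?thesis using fin e
      by (subst push_eq_point[of _ e]) (cases e; auto simp: seq_comp_def)+
  next
    case False
    \<comment> \<open>Only positions of \<open>A\<close> are missed by the embedding, and
      \<open>B\<close> never leads back to them.\<close>
    have "\<exists>p. t = Inl (Inl p)"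
    proof (cases t)
      case (Inl s)
      then show ?thesis using False by (cases s) (auto dest: spec[of _ "Inl _"])
    next
      case (Inr j)
      then show ?thesis using False by (auto dest: spec[of _ "Inr j"])
    qed
    then show ?thesis using False by (subst push_eq_0) (auto simp: seq_comp_def)
  qed
  ultimately show ?thesis by (simp add: flow_def)
qed

lemma seq_comp_roMDP: "A \<Zcomp> B \<in> roMDP m n"
proof (rule roMDP_I)
  show "entrances (A \<Zcomp> B) = m" "exit_count (A \<Zcomp> B) = n" "finite (positions (A \<Zcomp> B))"
    using roMDP_D[OF A] roMDP_D[OF B] by simp_all
  show "entry (A \<Zcomp> B) i \<in> targets (A \<Zcomp> B)" if "i \<in> {1..m}" for i
    using that roMDP_D(5)[OF A] then_entry_targets by simp
  show "reward (A \<Zcomp> B) s \<ge> 0" if "s \<in> positions (A \<Zcomp> B)" for s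
    using that roMDP_D(6)[OF A] roMDP_D(6)[OF B] by auto
  have ns: "(\<forall>u\<in>targets (A \<Zcomp> B). weight (A \<Zcomp> B) y u \<ge> 0) \<and>
      (\<Sum>u\<in>targets (A \<Zcomp> B). weight (A \<Zcomp> B) y u) \<in> {0, 1}" if "y \<in> sources (A \<Zcomp> B)" for y
    using that
  proof (cases rule: sources_seq_comp_cases)
    case (left x)
    show ?thesis unfolding left(2)
      using flow_nonneg_sum[OF A left(1) weight_flow_seq_comp_left[OF left(1)]] by blast
  next
    case (right q a)
    then have "Inr (q, a) \<in> sources B" by simp
    from flow_nonneg_sum[OF B this weight_flow_seq_comp_right[OF right(1)]]
    show ?thesis unfolding right(2) by blast
  qed
  then show "y \<in> sources (A \<Zcomp> B) \<Longrightarrow> u \<in> targets (A \<Zcomp> B) \<Longrightarrow> weight (A \<Zcomp> B) y u \<ge> 0"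
    and "y \<in> sources (A \<Zcomp> B) \<Longrightarrow> (\<Sum>u\<in>targets (A \<Zcomp> B). weight (A \<Zcomp> B) y u) \<in> {0, 1}" for y u
    by blast+
  fix y y' t
  assume y: "y \<in> sources (A \<Zcomp> B)" "weight (A \<Zcomp> B) y (Inr t) > 0"
    and y': "y' \<in> sources (A \<Zcomp> B)" "weight (A \<Zcomp> B) y' (Inr t) > 0" and t: "t \<in> {1..n}"
  have tB: "Inr t \<in> targets B" and tAB: "Inr t \<in> targets (A \<Zcomp> B)"
    using t roMDP_D(2)[OF B] by simp_all
  \<comment> \<open>\<open>w\<close> is the source of \<open>B\<close> through which
    \<open>z\<close> reaches the exit \<open>t\<close>: an entrance \<open>j\<close> if
    \<open>z\<close> comes from \<open>A\<close> and passes its exit \<open>j\<close>, and otherwise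
    \<open>z\<close> itself. Unique access of \<open>B\<close> determines \<open>w\<close>, and then
    unique access of \<open>A\<close> determines \<open>z\<close>.\<close>
  define origin where "origin z w \<longleftrightarrow> w \<in> sources B \<and> weight B w (Inr t) > 0 \<and>
      (case w of Inl j \<Rightarrow> (\<exists>x\<in>sources A. z = lift_left x \<and> Inr j \<in> targets A \<and> weight A x (Inr j) > 0)
        | Inr (q, a) \<Rightarrow> z = Inr (Inr q, a))" for z and w :: "nat + 'q \<times> 'a"
  have origin: "\<exists>w. origin z w"
    if z: "z \<in> sources (A \<Zcomp> B)" "weight (A \<Zcomp> B) z (Inr t) > 0" for z
    using z(1)
  proof (cases rule: sources_seq_comp_cases)
    case (left x)
    obtain u where u: "u \<in> targets A" "Inr t = then_entry B u" "weight A x u > 0"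
      by (rule flow_posD[OF weight_flow_seq_comp_left[OF left(1)] tAB z(2)[unfolded left(2)]])
    then obtain j where j: "u = Inr j" "entry B j = Inr t"
      by (cases u; cases "entry B (projr u)") auto
    then have "origin z (Inl j)"
      using u left roMDP_D(2)[OF A] roMDP_D(1)[OF B] by (auto simp: origin_def)
    then show ?thesis ..
  next
    case (right q a)
    obtain u where u: "u \<in> targets B" "(Inr t :: ('p + 'q) + nat) = map_sum Inr id u" "weight B (Inr (q, a)) u > 0"
      by (rule flow_posD[OF weight_flow_seq_comp_right[OF right(1)] tAB z(2)[unfolded right(2)]])
    then have "u = Inr t" by (cases u) auto
    then have "origin z (Inr (q, a))" using u right by (auto simp: origin_def)
    then show ?thesis ..
  qed
  obtain w w' where w: "origin y w" "origin y' w'" using origin y y' by blast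
  then have "w = w'" using roMDP_unique[OF B _ _ tB] by (simp add: origin_def)
  with w show "y = y'"
    using roMDP_unique[OF A] by (cases w) (auto simp: origin_def split: prod.splits)
qed

end

lemma flow_seq_comp_left:
  assumes "A \<in> roMDP m k" "B \<in> roMDP k n" "x \<in> sources A" "flow A x D R w"
  shows "flow (A \<Zcomp> B) (lift_left x) D (R OO (\<lambda>u v. v = then_entry B u)) w"
  using flow_trans[OF assms(4) weight_flow_seq_comp_left[OF assms(1-3)]] .

lemma flow_seq_comp_right:
  assumes "A \<in> roMDP m k" "B \<in> roMDP k n" "q \<in> positions B" "flow B (Inr (q, a)) D R w"
  shows "flow (A \<Zcomp> B) (Inr (Inr q, a)) D (R OO (\<lambda>u v. v = map_sum Inr id u)) w"
  using flow_trans[OF assms(4) weight_flow_seq_comp_right[OF assms(1-3)]] .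

section \<open>The sum as a push-forward\<close>

lemma sources_oplus_cases [consumes 2, case_names left right]:
  assumes "y \<in> sources (A \<oplus> B)" and m1: "entrances A = m1"
  obtains x where "x \<in> sources A" "y = lift_left x"
    | x where "x \<in> sources B" "y = lift_right m1 x"
proof (cases y)
  case (Inl i)
  show thesis
  proof (cases "i \<le> m1")
    case True
    then show thesis using Inl assms(1) that(1)[of "Inl i"] m1 by simp
  next
    case False
    then show thesis using Inl assms(1) that(2)[of "Inl (i - m1)"] m1 by force
  qed
next
  case (Inr z)
  obtain s a where z: "z = (s, a)" by (cases z)
  show thesis
  proof (cases s)
    case (Inl p)
    then show thesis using Inr assms(1) that(1)[of "Inr (p, a)"] by (auto simp: z)
  next
    case (Inr q)
    then show thesis using \<open>y = Inr z\<close> assms(1) that(2)[of "Inr (q, a)"] by (auto simp: z)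
  qed
qed

context
  fixes A :: "('p, 'a::finite) romdp" and B :: "('q, 'a) romdp" and m1 m2 n1 n2 :: nat
  assumes A: "A \<in> roMDP m1 n1" and B: "B \<in> roMDP m2 n2"
begin

lemma finite_targets_oplus: "finite (targets (A \<oplus> B))"
  using roMDP_D(3)[OF A] roMDP_D(3)[OF B] by (simp add: targets_def)

lemma weight_flow_oplus_left:
  assumes x: "x \<in> sources A"
  shows "flow (A \<oplus> B) (lift_left x) (targets A) (\<lambda>u v. v = map_sum Inl id u) (weight A x)"
proof -
  note fin = roMDP_D(3,4)[OF A]
  have "map_sum Inl id u \<in> targets (A \<oplus> B)" if "u \<in> targets A" for u
    using that by (cases u) auto
  then have "wiring (targets A) (targets (A \<oplus> B)) (\<lambda>u v. v = map_sum Inl id u)"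
    using fin finite_targets_oplus by (intro wiring_fun)
  moreover have "weight (A \<oplus> B) (lift_left x) t
      = push (targets A) (\<lambda>u v. v = map_sum Inl id u) (weight A x) t"
    if t: "t \<in> targets (A \<oplus> B)" for t
  proof (cases x)
    case (Inl i)
    then have "entry A i \<in> targets A" "i \<le> entrances A" using x roMDP_D(1,5)[OF A] by simp_all
    then show ?thesis using Inl fin(2) by (simp add: weight_Inl push_delta eq_commute[of t])
  next
    case (Inr y)
    then obtain p a where pa: "x = Inr (p, a)" by (cases y) auto
    show ?thesis
    proof (cases "\<exists>e\<in>targets A. t = map_sum Inl id e")
      case True
      then obtain e where e: "t = map_sum Inl id e" "e \<in> targets A" by blast
      have "t = map_sum Inl id u \<longleftrightarrow> u = e" for u :: "'p + nat" using e by (cases u; cases e) auto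
      then show ?thesis using fin e
        by (subst push_eq_point[of _ e]) (cases e; auto simp: pa oplus_def)+
    next
      case False
      have "weight (A \<oplus> B) (lift_left x) t = 0"
      proof (cases t)
        case (Inl s)
        then show ?thesis using False t
          by (cases s) (auto simp: pa oplus_def dest: bspec[of _ _ "Inl _"])
      next
        case (Inr j)
        then show ?thesis using False t
          by (auto simp: pa oplus_def dest: bspec[of _ _ "Inr j"])
      qed
      then show ?thesis using False by (subst push_eq_0) auto
    qed
  qed
  ultimately show ?thesis by (simp add: flow_def)
qed

lemma weight_flow_oplus_right:
  assumes x: "x \<in> sources B"
  shows "flow (A \<oplus> B) (lift_right m1 x) (targets B) (\<lambda>u v. v = map_sum Inr (\<lambda>t. t + n1) u)
    (weight B x)"
proof -
  note fin = roMDP_D(3,4)[OF B] and cA = roMDP_D(1,2)[OF A]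
  have "map_sum Inr (\<lambda>t. t + n1) u \<in> targets (A \<oplus> B)" if "u \<in> targets B" for u
    using that cA by (cases u) auto
  then have "wiring (targets B) (targets (A \<oplus> B)) (\<lambda>u v. v = map_sum Inr (\<lambda>t. t + n1) u)"
    using fin finite_targets_oplus by (intro wiring_fun)
  moreover have "weight (A \<oplus> B) (lift_right m1 x) t
      = push (targets B) (\<lambda>u v. v = map_sum Inr (\<lambda>t. t + n1) u) (weight B x) t"
    if t: "t \<in> targets (A \<oplus> B)" for t
  proof (cases x)
    case (Inl i)
    then have "entry B i \<in> targets B" "1 \<le> i" using x roMDP_D(1,5)[OF B] by simp_all
    moreover have "entry (A \<oplus> B) (i + m1) = map_sum Inr (\<lambda>t. t + n1) (entry B i)"
      using oplus_simps(6)[of i A B] \<open>1 \<le> i\<close> cA by simp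
    ultimately show ?thesis using Inl fin(2) by (simp add: weight_Inl push_delta eq_commute[of t])
  next
    case (Inr y)
    then obtain q a where qa: "x = Inr (q, a)" by (cases y) auto
    show ?thesis
    proof (cases "\<exists>e\<in>targets B. t = map_sum Inr (\<lambda>t. t + n1) e")
      case True
      then obtain e where e: "t = map_sum Inr (\<lambda>t. t + n1) e" "e \<in> targets B" by blast
      have "t = map_sum Inr (\<lambda>t. t + n1) u \<longleftrightarrow> u = e" for u :: "'q + nat"
        using e by (cases u; cases e) auto
      then show ?thesis using fin e cA
        by (subst push_eq_point[of _ e]) (cases e; auto simp: qa oplus_def)+
    next
      case False
      have *: "t \<noteq> Inr (j + n1)" if "j \<in> {1..exit_count B}" for j
        using False that by (auto dest: bspec[of _ _ "Inr j"])
      have "weight (A \<oplus> B) (lift_right m1 x) t = 0"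
      proof (cases t)
        case (Inl s)
        then show ?thesis using False t
          by (cases s) (auto simp: qa oplus_def dest: bspec[of _ _ "Inl _"])
      next
        case (Inr j)
        then show ?thesis using *[of "j - n1"] t cA by (force simp: qa oplus_def)
      qed
      then show ?thesis using False by (subst push_eq_0) auto
    qed
  qed
  ultimately show ?thesis by (simp add: flow_def)
qed

lemma oplus_roMDP: "A \<oplus> B \<in> roMDP (m1 + m2) (n1 + n2)"
proof (rule roMDP_I)
  note cA = roMDP_D(1,2)[OF A] and cB = roMDP_D(1,2)[OF B]
  show "entrances (A \<oplus> B) = m1 + m2" "exit_count (A \<oplus> B) = n1 + n2" "finite (positions (A \<oplus> B))"
    using roMDP_D[OF A] roMDP_D[OF B] by simp_all
  show "entry (A \<oplus> B) i \<in> targets (A \<oplus> B)" if i: "i \<in> {1..m1 + m2}" for i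
  proof (cases "i \<le> m1")
    case True
    then have "entry A i \<in> targets A" using i roMDP_D(5)[OF A] by simp
    then show ?thesis using True cA by (cases "entry A i") auto
  next
    case False
    then have "entry B (i - m1) \<in> targets B" using i roMDP_D(5)[OF B] by simp
    then show ?thesis using False cA oplus_simps(6)[of "i - m1" A B]
      by (cases "entry B (i - m1)") auto
  qed
  show "reward (A \<oplus> B) s \<ge> 0" if "s \<in> positions (A \<oplus> B)" for s
    using that roMDP_D(6)[OF A] roMDP_D(6)[OF B] by auto
  have ns: "(\<forall>u\<in>targets (A \<oplus> B). weight (A \<oplus> B) y u \<ge> 0) \<and>
      (\<Sum>u\<in>targets (A \<oplus> B). weight (A \<oplus> B) y u) \<in> {0, 1}" if "y \<in> sources (A \<oplus> B)" for y
    using that cA(1)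
  proof (cases rule: sources_oplus_cases)
    case (left x)
    show ?thesis unfolding left(2)
      using flow_nonneg_sum[OF A left(1) weight_flow_oplus_left[OF left(1)]] by blast
  next
    case (right x)
    show ?thesis unfolding right(2)
      using flow_nonneg_sum[OF B right(1) weight_flow_oplus_right[OF right(1)]] by blast
  qed
  then show "y \<in> sources (A \<oplus> B) \<Longrightarrow> u \<in> targets (A \<oplus> B) \<Longrightarrow> weight (A \<oplus> B) y u \<ge> 0"
    and "y \<in> sources (A \<oplus> B) \<Longrightarrow> (\<Sum>u\<in>targets (A \<oplus> B). weight (A \<oplus> B) y u) \<in> {0, 1}" for y u
    by blast+
  fix y y' t
  assume y: "y \<in> sources (A \<oplus> B)" "weight (A \<oplus> B) y (Inr t) > 0"
    and y': "y' \<in> sources (A \<oplus> B)" "weight (A \<oplus> B) y' (Inr t) > 0" and t: "t \<in> {1..n1 + n2}"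
  have tAB: "Inr t \<in> targets (A \<oplus> B)" using t cA cB by simp
  \<comment> \<open>Exits up to \<open>n1\<close> are accessed from \<open>A\<close> only and later
    ones from \<open>B\<close> only, so unique access reduces to one component.\<close>
  have origin: "(\<exists>x\<in>sources A. z = lift_left x \<and> Inr t \<in> targets A \<and> weight A x (Inr t) > 0) \<and> t \<le> n1 \<or>
      (\<exists>x\<in>sources B. z = lift_right m1 x \<and> Inr (t - n1) \<in> targets B \<and> weight B x (Inr (t - n1)) > 0)
        \<and> t > n1"
    if z: "z \<in> sources (A \<oplus> B)" "weight (A \<oplus> B) z (Inr t) > 0" for z
    using z(1) cA(1)
  proof (cases rule: sources_oplus_cases)
    case (left x)
    obtain u where u: "u \<in> targets A" "(Inr t :: ('p + 'q) + nat) = map_sum Inl id u" "weight A x u > 0"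
      by (rule flow_posD[OF weight_flow_oplus_left[OF left(1)] tAB z(2)[unfolded left(2)]])
    then have "u = Inr t" by (cases u) auto
    then show ?thesis using u left cA by auto
  next
    case (right x)
    obtain u where u: "u \<in> targets B" "(Inr t :: ('p + 'q) + nat) = map_sum Inr (\<lambda>t. t + n1) u" "weight B x u > 0"
      by (rule flow_posD[OF weight_flow_oplus_right[OF right(1)] tAB z(2)[unfolded right(2)]])
    then obtain j where "u = Inr j" "t = j + n1" by (cases u) auto
    then show ?thesis using u right cB by auto
  qed
  show "y = y'"
  proof (cases "t \<le> n1")
    case True
    then show ?thesis using origin[OF y] origin[OF y'] roMDP_unique[OF A] by fastforce
  next
    case False
    then show ?thesis using origin[OF y] origin[OF y'] roMDP_unique[OF B] by fastforce
  qed
qed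

end

lemma flow_oplus_left:
  assumes "A \<in> roMDP m1 n1" "B \<in> roMDP m2 n2" "x \<in> sources A" "flow A x D R w"
  shows "flow (A \<oplus> B) (lift_left x) D (R OO (\<lambda>u v. v = map_sum Inl id u)) w"
  using flow_trans[OF assms(4) weight_flow_oplus_left[OF assms(1-3)]] .

lemma flow_oplus_right:
  assumes "A \<in> roMDP m1 n1" "B \<in> roMDP m2 n2" "x \<in> sources B" "flow B x D R w"
  shows "flow (A \<oplus> B) (lift_right m1 x) D (R OO (\<lambda>u v. v = map_sum Inr (\<lambda>t. t + n1) u)) w"
  using flow_trans[OF assms(4) weight_flow_oplus_right[OF assms(1-3)]] .

subsection \<open>Trace\<close>

text \<open>A least fixed point in place of a first index: a wire that circles forever is related to
  nothing, and properties follow by rule induction. The first target is numbered as in the system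
  with the loop, the second one as in its trace.\<close>

inductive resolves :: "nat \<Rightarrow> nat \<Rightarrow> (nat \<Rightarrow> 'q + nat) \<Rightarrow> 'q + nat \<Rightarrow> 'q + nat \<Rightarrow> bool"
  for l n E where
  position: "resolves l n E (Inl q) (Inl q)"
| exit: "t \<in> {1..n} \<Longrightarrow> resolves l n E (Inr (t + l)) (Inr t)"
| feedback: "j \<in> {1..l} \<Longrightarrow> resolves l n E (E j) t \<Longrightarrow> resolves l n E (Inr j) t"

lemma resolves_Inl [simp]: "resolves l n E (Inl q) t \<longleftrightarrow> t = Inl q"
  by (auto elim: resolves.cases intro: resolves.position)

lemma resolves_feedback_iff:
  "j \<in> {1..l} \<Longrightarrow> resolves l n E (Inr j) t \<longleftrightarrow> resolves l n E (E j) t"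
  by (auto elim: resolves.cases intro: resolves.feedback)

lemma resolves_exit_iff [simp]:
  "1 \<le> i \<Longrightarrow> resolves l n E (Inr (i + l)) t \<longleftrightarrow> i \<le> n \<and> t = Inr i"
  by (auto elim: resolves.cases intro: resolves.exit)

text \<open>The shape of \<open>u\<close> decides which rule applies, since \<open>t + l\<close>
  with t \<ge> 1 lies beyond the traced wires.\<close>

lemma resolves_unique: "resolves l n E u t \<Longrightarrow> resolves l n E u t' \<Longrightarrow> t = t'"
proof (induction arbitrary: t' rule: resolves.induct)
  case (exit t)
  then show ?case by simp
next
  case (feedback j t)
  then show ?case by (simp add: resolves_feedback_iff)
qed simp

lemma resolves_closed:
  assumes "resolves l n E u t" "u \<in> Q <+> X" "\<And>j. j \<in> {1..l} \<Longrightarrow> E j \<in> Q <+> X"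
  shows "t \<in> Q <+> {1..n}"
  using assms by (induction rule: resolves.induct) auto

text \<open>The single steps of the loop as a relation, so that confluence of single-valued
  relations becomes available for its converse.\<close>

definition feedback_rel :: "nat \<Rightarrow> (nat \<Rightarrow> 'q + nat) \<Rightarrow> ('q + nat) rel" where
  "feedback_rel l E = {(Inr j, E j) | j. j \<in> {1..l}}"

lemma resolves_exit_chain:
  "resolves l n E u t \<Longrightarrow> t = Inr i \<Longrightarrow> (u, Inr (i + l)) \<in> (feedback_rel l E)\<^sup>*"
proof (induction rule: resolves.induct)
  case (feedback j t)
  then show ?case by (auto simp: feedback_rel_def intro: converse_rtrancl_into_rtrancl)
qed auto

text \<open>Entrances reach pairwise distinct exits, so chains of feedback steps merge only if one is
  a suffix of the other.\<close>
lemma resolves_exit_inj: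
  assumes inj: "\<And>i j t. i \<in> {1..l} \<Longrightarrow> j \<in> {1..l} \<Longrightarrow> E i = Inr t \<Longrightarrow> E j = Inr t \<Longrightarrow> i = j"
    and u: "resolves l n E u (Inr t)" "u \<notin> E ` {1..l}"
    and v: "resolves l n E v (Inr t)" "v \<notin> E ` {1..l}"
  shows "u = v"
proof -
  \<comment> \<open>Several wires may lead to one position, so only the steps that end in a wire are
    injective. A chain that ends in an exit contains no others, because no step leaves a
    position.\<close>
  define r where "r = {(x, y) \<in> feedback_rel l E. isl y = False}"
  have chain: "(x, Inr (t + l)) \<in> r\<^sup>*" if "(x, Inr (t + l)) \<in> (feedback_rel l E)\<^sup>*" for x
    using that
  proof (induction rule: converse_rtrancl_induct)
    case (step x y)
    then have "isl y = False" by (auto elim: converse_rtranclE simp: feedback_rel_def)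
    with step show ?case by (auto simp: r_def intro: converse_rtrancl_into_rtrancl)
  qed simp
  have sv: "single_valued (r\<inverse>)"
    using inj by (auto simp: single_valued_def r_def feedback_rel_def isl_def split: sum.splits)
      (metis sum.collapse(2) isl_def)
  have "(Inr (t + l), u) \<in> (r\<inverse>)\<^sup>*" "(Inr (t + l), v) \<in> (r\<inverse>)\<^sup>*"
    using chain[OF resolves_exit_chain[OF u(1) refl]] chain[OF resolves_exit_chain[OF v(1) refl]]
    by (simp_all add: rtrancl_converse)
  from single_valued_confluent[OF sv this]
  have "(u, v) \<in> r\<^sup>* \<or> (v, u) \<in> r\<^sup>*" by (auto simp: rtrancl_converse)
  \<comment> \<open>What is not fed back has no predecessor, so a chain ending in it has length
    zero.\<close>
  moreover have "x = y" if "(x, y) \<in> r\<^sup>*" "y \<notin> E ` {1..l}" for x y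
    using that by (auto elim: rtranclE simp: r_def feedback_rel_def)
  ultimately show ?thesis using u(2) v(2) by blast
qed

text \<open>Feedback maps the finite set of unresolved wires injectively, hence surjectively, to itself.\<close>
lemma resolves_total:
  assumes inj: "\<And>i j t. i \<in> {1..l} \<Longrightarrow> j \<in> {1..l} \<Longrightarrow> E i = Inr t \<Longrightarrow> E j = Inr t \<Longrightarrow> i = j"
    and E: "\<And>j. j \<in> {1..l} \<Longrightarrow> E j \<in> Q <+> {1..l + n}"
    and u: "u \<in> Q <+> {1..l + n}" "u \<notin> E ` {1..l} \<or> isl u"
  shows "\<exists>t. resolves l n E u t"
proof (rule ccontr)
  assume un: "\<nexists>t. resolves l n E u t"
  define D where "D = {j \<in> {1..l}. \<nexists>t. resolves l n E (Inr j) t}"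
  \<comment> \<open>Positions and untraced exits resolve at once; hence whatever is unresolved is a
    traced wire.\<close>
  have unresolved: "\<exists>j\<in>D. v = Inr j" if v: "v \<in> Q <+> {1..l + n}" "\<nexists>t. resolves l n E v t" for v
  proof (cases v)
    case (Inl q)
    then show ?thesis using v(2) by simp
  next
    case (Inr j)
    have "j \<le> l"
    proof (rule ccontr)
      assume "\<not> j \<le> l"
      then have "resolves l n E (Inr (j - l + l)) (Inr (j - l))"
        using v(1) Inr by (intro resolves.exit) auto
      then show False using v(2) Inr \<open>\<not> j \<le> l\<close> by auto
    qed
    then show ?thesis using v Inr by (auto simp: D_def)
  qed
  have step: "\<exists>j'\<in>D. E j = Inr j'" if "j \<in> D" for j
    using that E unresolved[of "E j"] by (auto simp: D_def resolves_feedback_iff)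
  define e where "e j = projr (E j)" for j
  have e: "e j \<in> D \<and> E j = Inr (e j)" if "j \<in> D" for j
    using step[OF that] by (auto simp: e_def)
  have "inj_on e D"
  proof (rule inj_onI)
    fix i j assume "i \<in> D" "j \<in> D" "e i = e j"
    then show "i = j" using e[of i] e[of j] inj[of i j "e j"] by (auto simp: D_def)
  qed
  moreover have "finite D" by (simp add: D_def)
  ultimately have surj: "e ` D = D" using e by (intro endo_inj_surj) auto
  \<comment> \<open>By surjectivity \<open>u\<close> has a predecessor on a traced wire, so it is
    fed back, and it is a wire: the assumption excludes both at once.\<close>
  obtain j where j: "j \<in> D" "u = Inr j" using unresolved[OF u(1) un] by blast
  then obtain i where "i \<in> D" "j = e i" using surj by blast
  then have "u = E i" "i \<in> {1..l}" using e[of i] j by (auto simp: D_def)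
  then have "u \<in> E ` {1..l}" by (rule image_eqI)
  with j(2) u(2) show False by simp
qed

section \<open>Agreement of the inductive relation with the sequences of the definition\<close>

definition target_seq :: "('q, 'a) romdp \<Rightarrow> 'q + nat \<Rightarrow> nat \<Rightarrow> 'q + nat" where
  "target_seq A u k = (case u of Inl q \<Rightarrow> Inl q | Inr i \<Rightarrow> entry_seq A i k)"

text \<open>The sequences of the definition start at an entrance, whereas \<open>resolves\<close>
  starts at a target; the first passage through the entry map accounts for the shift of the
  index.\<close>

lemma entry_seq_Suc: "entry_seq A i (Suc k) = target_seq A (entry A i) k"
proof (induction k)
  case 0
  then show ?case by (simp add: target_seq_def split: sum.splits)
next
  case (Suc k)
  then show ?case by (subst entry_seq.simps) (simp add: target_seq_def split: sum.splits)
qed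

text \<open>\<open>v\<close> is a target outside of the loop, numbered as in the system itself, and
  \<open>t\<close> is the same target numbered as in the trace.\<close>

definition leaves :: "nat \<Rightarrow> nat \<Rightarrow> 'q + nat \<Rightarrow> 'q + nat \<Rightarrow> bool" where
  "leaves l n v t \<longleftrightarrow> (\<exists>q. v = Inl q \<and> t = Inl q) \<or> (\<exists>i\<in>{1..n}. v = Inr (i + l) \<and> t = Inr i)"

lemma target_seq_0 [simp]: "target_seq A u 0 = u"
  by (simp add: target_seq_def split: sum.splits)

text \<open>The index \<open>k\<close> counts the uses of the rule \<open>feedback\<close>, so
  induction on it matches rule induction.\<close>

lemma resolves_iff_target_seq:
  "resolves l n (entry A) u t \<longleftrightarrow>
    (\<exists>k. leaves l n (target_seq A u k) t \<and> (\<forall>j<k. target_seq A u j \<in> Inr ` {1..l}))" (is "_ \<longleftrightarrow> ?R u t")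
proof
  show "?R u t" if "resolves l n (entry A) u t"
    using that
  proof (induction rule: resolves.induct)
    case (position q)
    then show ?case by (intro exI[of _ 0]) (simp add: leaves_def)
  next
    case (exit t)
    then show ?case by (intro exI[of _ 0]) (simp add: leaves_def)
  next
    case (feedback i t)
    then obtain k where k: "leaves l n (target_seq A (entry A i) k) t"
      "\<forall>j<k. target_seq A (entry A i) j \<in> Inr ` {1..l}" by blast
    have "target_seq A (Inr i) (Suc j) = target_seq A (entry A i) j" for j
      by (simp add: target_seq_def[of A "Inr i"] entry_seq_Suc del: entry_seq.simps)
    then have "leaves l n (target_seq A (Inr i) (Suc k)) t \<and>
        (\<forall>j<Suc k. target_seq A (Inr i) j \<in> Inr ` {1..l})"
      using k feedback(1) by (auto simp: less_Suc_eq_0_disj)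
    then show ?case by blast
  qed
  have "resolves l n (entry A) u t"
    if "leaves l n (target_seq A u k) t" "\<forall>j<k. target_seq A u j \<in> Inr ` {1..l}" for k
    using that
  proof (induction k arbitrary: u)
    case 0
    then show ?case by (auto simp: leaves_def)
  next
    case (Suc k)
    from Suc.prems(2) have "target_seq A u 0 \<in> Inr ` {1..l}" by blast
    then obtain i where i: "u = Inr i" "i \<in> {1..l}" by auto
    have *: "target_seq A u (Suc j) = target_seq A (entry A i) j" for j
      unfolding i by (simp add: target_seq_def[of A "Inr i"] entry_seq_Suc del: entry_seq.simps)
    have "resolves l n (entry A) (entry A i) t"
    proof (rule Suc.IH)
      show "leaves l n (target_seq A (entry A i) k) t" using Suc.prems(1) * by simp
      show "\<forall>j<k. target_seq A (entry A i) j \<in> Inr ` {1..l}" using Suc.prems(2) *[symmetric] by auto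
    qed
    then show ?case unfolding i(1) using i(2) by (rule resolves.feedback[rotated])
  qed
  then show "?R u t \<Longrightarrow> resolves l n (entry A) u t" by blast
qed

section \<open>The trace as a push-forward\<close>

lemma trace_simps [simp]:
  "entrances (trace l m n A) = m" "exit_count (trace l m n A) = n"
  "positions (trace l m n A) = positions A" "reward (trace l m n A) = reward A"
  "entry (trace l m n A) = trace_entry l n A"
  by (simp_all add: trace_def)

lemma targets_trace: "targets (trace l m n A) = positions A <+> {1..n}"
  by (simp add: targets_def)

context
  fixes A :: "('q, 'a::finite) romdp" and l m n :: nat
  assumes A: "A \<in> roMDP (l + m) (l + n)"
begin

lemma targets_traced: "targets A = positions A <+> {1..l + n}"
  by (simp add: targets_def roMDP_D(2)[OF A])

lemma entry_traced: "j \<in> {1..l} \<Longrightarrow> entry A j \<in> positions A <+> {1..l + n}"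
  using roMDP_D(5)[OF A, of j] by (simp add: targets_traced)

lemma entry_traced_inj:
  "i \<in> {1..l} \<Longrightarrow> j \<in> {1..l} \<Longrightarrow> entry A i = Inr t \<Longrightarrow> entry A j = Inr t \<Longrightarrow> i = j"
  by (rule roMDP_entry_inj[OF A]) auto

lemma resolves_targets:
  "resolves l n (entry A) u t \<Longrightarrow> u \<in> targets A \<Longrightarrow> t \<in> targets (trace l m n A)"
  unfolding targets_traced targets_trace by (rule resolves_closed[OF _ _ entry_traced])

abbreviation untrace :: "nat + 'q \<times> 'a \<Rightarrow> nat + 'q \<times> 'a" where
  "untrace \<equiv> map_sum (\<lambda>i. i + l) id"

lemma untrace_source: "x \<in> sources (trace l m n A) \<Longrightarrow> untrace x \<in> sources A"
  using roMDP_D(1)[OF A] by (cases x) auto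

text \<open>Otherwise a traced entrance and \<open>untrace x\<close> would access the same exit.
  They are different sources, as the entrances of the trace are numbered from \<open>l + 1\<close>
  on in \<open>A\<close>. Positions are exempt because they may be accessed from anywhere.\<close>

lemma source_not_fed_back:
  assumes x: "x \<in> sources (trace l m n A)" and u: "u \<in> targets A" "weight A (untrace x) u > 0"
  shows "u \<notin> entry A ` {1..l} \<or> isl u"
proof (rule ccontr)
  assume "\<not> ?thesis"
  then obtain j t where j: "j \<in> {1..l}" "entry A j = Inr t" "u = Inr t" by (auto simp: isl_def) (metis sum.exhaust_sel)
  have "Inl j = untrace x"
    using roMDP_unique[OF A _ untrace_source[OF x], of "Inl j" t] j u roMDP_D(1)[OF A] by simp
  then show False using x j by (cases x) auto
qed

lemma source_resolves:
  assumes "x \<in> sources (trace l m n A)" "u \<in> targets A" "weight A (untrace x) u > 0"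
  shows "\<exists>t. resolves l n (entry A) u t"
proof (rule resolves_total)
  show "u \<in> positions A <+> {1..l + n}" using assms(2) targets_traced by simp
qed (use source_not_fed_back[OF assms] entry_traced entry_traced_inj in blast)+

lemma trace_entry_resolves:
  assumes "i \<in> {1..m}"
  shows "resolves l n (entry A) (entry A (i + l)) t \<longleftrightarrow> t = trace_entry l n A i"
proof -
  have e: "entry A (i + l) \<in> targets A" using assms by (intro roMDP_D(5)[OF A]) auto
  obtain t0 where t0: "resolves l n (entry A) (entry A (i + l)) t0"
    using source_resolves[of "Inl i" "entry A (i + l)"] assms e by auto
  then obtain k where k: "leaves l n (target_seq A (entry A (i + l)) k) t0"
      "\<forall>j<k. target_seq A (entry A (i + l)) j \<in> Inr ` {1..l}"
    unfolding resolves_iff_target_seq by blast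
  have "t0 \<in> targets (trace l m n A)" using resolves_targets[OF t0 e] .
  then have in_k: "target_seq A (entry A (i + l)) k \<in> positions A <+> {l + 1..l + n}"
    using k(1) by (auto simp: leaves_def targets_trace)
  \<comment> \<open>Index 0 is the entrance \<open>i + l\<close> itself, hence \<open>Suc k\<close>.
    The values at the indices 1 to \<open>k\<close> precede the exit from the loop, so they are
    traced wires and do not qualify.\<close>
  have "(LEAST k. 0 < k \<and> entry_seq A (i + l) k \<in> positions A <+> {l + 1..l + n}) = Suc k"
  proof (rule Least_equality)
    show "0 < Suc k \<and> entry_seq A (i + l) (Suc k) \<in> positions A <+> {l + 1..l + n}"
      using in_k unfolding entry_seq_Suc by simp
    fix k' assume k': "0 < k' \<and> entry_seq A (i + l) k' \<in> positions A <+> {l + 1..l + n}"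
    then obtain j where j: "k' = Suc j" by (cases k') auto
    have "\<not> j < k" using k(2) k' unfolding j entry_seq_Suc by fastforce
    then show "Suc k \<le> k'" using j by simp
  qed
  then have "trace_entry l n A i = map_sum id (\<lambda>t. t - l) (target_seq A (entry A (i + l)) k)"
    unfolding trace_entry_def by (simp add: entry_seq_Suc del: entry_seq.simps)
  also have "\<dots> = t0" using k(1) by (auto simp: leaves_def)
  finally show ?thesis using t0 resolves_unique by blast
qed

lemma prec_iff_resolves:
  assumes "leaves l n v t"
  shows "i \<in> prec l A v \<longleftrightarrow> i \<in> {1..l} \<and> resolves l n (entry A) (Inr i) t"
proof -
  have "leaves l n v' t \<longleftrightarrow> v' = v" for v' :: "'q + nat" using assms by (auto simp: leaves_def)
  then show ?thesis unfolding resolves_iff_target_seq prec_def by (auto simp: target_seq_def)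
qed

lemma weight_flow_trace:
  assumes x: "x \<in> sources (trace l m n A)"
  shows "flow (trace l m n A) x (targets A) (resolves l n (entry A)) (weight A (untrace x))"
proof -
  have fin: "finite (targets A)" "finite (targets (trace l m n A))"
    using roMDP_D(3,4)[OF A] by (simp_all add: targets_trace)
  then have "wiring (targets A) (targets (trace l m n A)) (resolves l n (entry A))"
    using resolves_targets resolves_unique unfolding wiring_def by blast
  moreover have "weight (trace l m n A) x t = push (targets A) (resolves l n (entry A)) (weight A (untrace x)) t"
    if t: "t \<in> targets (trace l m n A)" for t
  proof (cases x)
    case (Inl i)
    then have "entry A (i + l) \<in> targets A" using x by (intro roMDP_D(5)[OF A]) auto
    then show ?thesis using Inl fin(1) x
      by (simp add: weight_Inl push_delta trace_entry_resolves eq_commute[of t])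
  next
    case (Inr y)
    then obtain q a where qa: "x = Inr (q, a)" by (cases y) auto
    define v where "v = map_sum id (\<lambda>i. i + l) t"
    have v: "leaves l n v t" "v \<in> targets A"
      using t by (auto simp: v_def leaves_def targets_trace targets_traced)
    have resolves_v: "resolves l n (entry A) v t"
      using v(1) by (auto simp: leaves_def)
    \<comment> \<open>The targets that resolve to \<open>t\<close> are \<open>v\<close>, which is
      not traced, and the traced wires leading to \<open>v\<close>. They yield the two summands in
      the definition of the transition weights.\<close>
    have set_eq: "{u \<in> targets A. resolves l n (entry A) u t} = insert v (Inr ` prec l A v)"
    proof (intro equalityI subsetI)
      fix u assume "u \<in> {u \<in> targets A. resolves l n (entry A) u t}"
      then have u: "u \<in> targets A" "resolves l n (entry A) u t" by auto
      from u(2) show "u \<in> insert v (Inr ` prec l A v)"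
      proof cases
        case (feedback j)
        then show ?thesis using u by (auto simp: prec_iff_resolves[OF v(1)])
      qed (auto simp: v_def)
    next
      fix u assume "u \<in> insert v (Inr ` prec l A v)"
      then show "u \<in> {u \<in> targets A. resolves l n (entry A) u t}"
        using v(2) prec_iff_resolves[OF v(1)] resolves_v by (auto simp: targets_traced)
    qed
    have "v \<notin> Inr ` prec l A v" using v(1) by (auto simp: prec_def leaves_def)
    moreover have "finite (prec l A v)" by (simp add: prec_def)
    moreover have "push (targets A) (resolves l n (entry A)) (prob A q a) t
        = sum (prob A q a) {u \<in> targets A. resolves l n (entry A) u t}"
      unfolding push_def using fin by (simp add: Collect_conj_eq)
    ultimately have "push (targets A) (resolves l n (entry A)) (prob A q a) t
        = prob A q a v + (\<Sum>i\<in>prec l A v. prob A q a (Inr i))"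
      unfolding set_eq by (simp add: sum.reindex)
    moreover have "weight (trace l m n A) x t = prob A q a v + (\<Sum>i\<in>prec l A v. prob A q a (Inr i))"
      by (cases t) (simp_all add: qa v_def trace_def)
    moreover have "weight A (Inr (q, a)) = prob A q a" by (rule ext) simp
    ultimately show ?thesis by (simp add: qa)
  qed
  ultimately show ?thesis by (simp add: flow_def)
qed

lemma trace_roMDP: "trace l m n A \<in> roMDP m n"
proof (rule roMDP_I)
  show "entry (trace l m n A) i \<in> targets (trace l m n A)" if "i \<in> {1..m}" for i
    using trace_entry_resolves[OF that] resolves_targets roMDP_D(5)[OF A, of "i + l"] that by auto
  show "y \<in> sources (trace l m n A) \<Longrightarrow> u \<in> targets (trace l m n A) \<Longrightarrow> weight (trace l m n A) y u \<ge> 0"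
    and "y \<in> sources (trace l m n A) \<Longrightarrow>
      (\<Sum>u\<in>targets (trace l m n A). weight (trace l m n A) y u) \<in> {0, 1}" for y u
  proof -
    assume y: "y \<in> sources (trace l m n A)"
    note * = flow_nonneg_sum[OF A untrace_source[OF y] weight_flow_trace[OF y] source_resolves[OF y]]
    show "(\<Sum>u\<in>targets (trace l m n A). weight (trace l m n A) y u) \<in> {0, 1}" by (rule *(2))
    show "weight (trace l m n A) y u \<ge> 0" if "u \<in> targets (trace l m n A)" using *(1) that by blast
  qed
  fix x y t
  assume x: "x \<in> sources (trace l m n A)" "weight (trace l m n A) x (Inr t) > 0"
    and y: "y \<in> sources (trace l m n A)" "weight (trace l m n A) y (Inr t) > 0" and t: "t \<in> {1..n}"
  then have t': "Inr t \<in> targets (trace l m n A)" by simp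
  obtain u where u: "u \<in> targets A" "resolves l n (entry A) u (Inr t)" "weight A (untrace x) u > 0"
    by (rule flow_posD[OF weight_flow_trace[OF x(1)] t' x(2)])
  obtain v where v: "v \<in> targets A" "resolves l n (entry A) v (Inr t)" "weight A (untrace y) v > 0"
    by (rule flow_posD[OF weight_flow_trace[OF y(1)] t' y(2)])
  obtain i j where ij: "u = Inr i" "v = Inr j" using u(2) v(2) by (cases u; cases v) auto
  \<comment> \<open>Neither \<open>u\<close> nor \<open>v\<close> is fed back, as both are wires
    carrying weight of a source; so their paths to the same exit start at the same wire.\<close>
  have "u = v"
    using source_not_fed_back[OF x(1) u(1,3)] source_not_fed_back[OF y(1) v(1,3)] ij
    by (intro resolves_exit_inj[OF entry_traced_inj u(2) _ v(2)]) auto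
  then have "untrace x = untrace y"
    using roMDP_unique[OF A untrace_source[OF x(1)] untrace_source[OF y(1)]] u v ij by simp
  then show "x = y" by (cases x; cases y) auto
qed (use roMDP_D[OF A] in simp_all)

end

lemma trace_entry_eqI:
  assumes "A \<in> roMDP (l + m) (l + n)" "i \<in> {1..m}" "resolves l n (entry A) (entry A (i + l)) t"
  shows "trace_entry l n A i = t"
  using trace_entry_resolves[OF assms(1,2), of t] assms(3) by simp

lemma flow_trace:
  assumes "A \<in> roMDP (l + m) (l + n)" "x \<in> sources (trace l m n A)"
    "flow A (map_sum (\<lambda>i. i + l) id x) D R w"
  shows "flow (trace l m n A) x D (R OO resolves l n (entry A)) w"
  using flow_trans[OF assms(3) weight_flow_trace[OF assms(1,2)]] .

subsection \<open>Comparison of feedback loops\<close>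

text \<open>Both loops have the same traced wires, fixed by \<open>h\<close>, and their entry maps
  differ by \<open>h\<close>. Once the first loop is left, \<open>out\<close> says how the second
  one goes on. For Superposing and naturality at the entrances \<open>h\<close> embeds positions;
  for naturality at the exits it sends targets on through \<open>B\<close>.\<close>

lemma resolves_simulation:
  assumes E: "\<And>j. j \<in> {1..l} \<Longrightarrow> h (Inr j) = Inr j" "\<And>j. j \<in> {1..l} \<Longrightarrow> E' j = h (E j)"
    and range: "\<And>j. j \<in> {1..l} \<Longrightarrow> E j \<in> Q <+> {1..l + n}"
    and out: "\<And>q t. q \<in> Q \<Longrightarrow> resolves l n' E' (h (Inl q)) t \<longleftrightarrow> t = h' (Inl q)"
      "\<And>i t. i \<in> {1..n} \<Longrightarrow> resolves l n' E' (h (Inr (i + l))) t \<longleftrightarrow> t = h' (Inr i)"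
    and u: "u \<in> Q <+> {1..l + n}"
  shows "resolves l n' E' (h u) t \<longleftrightarrow> (resolves l n E OO (\<lambda>v t. t = h' v)) u t"
proof
  have "resolves l n E u v \<Longrightarrow> u \<in> Q <+> {1..l + n} \<Longrightarrow> resolves l n' E' (h u) (h' v)" for v u
  proof (induction rule: resolves.induct)
    case (feedback j v)
    then show ?case using E[of j] range[of j] by (simp add: resolves_feedback_iff)
  qed (auto simp: out)
  then show "(resolves l n E OO (\<lambda>v t. t = h' v)) u t \<Longrightarrow> resolves l n' E' (h u) t"
    using u by auto
  \<comment> \<open>Off the traced wires \<open>out\<close> decides everything, so induction on the
    second loop is needed only while \<open>u\<close> is traced.\<close>
  have outside: "\<exists>v. resolves l n E u v \<and> t = h' v"
    if t: "resolves l n' E' (h u) t" and u: "u \<in> Q <+> {1..l + n}" "u \<notin> Inr ` {1..l}" for u t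
  proof (cases u)
    case (Inl q)
    then show ?thesis using t u(1) out(1)[of q t] by auto
  next
    case (Inr j)
    then have "j - l \<in> {1..n}" "j = (j - l) + l" using u by (auto simp: image_iff)
    then show ?thesis using t out(2)[of "j - l" t] Inr resolves.exit[of "j - l" n l E] by auto
  qed
  have "\<exists>v. resolves l n E u v \<and> t = h' v"
    if "resolves l n' E' x t" "x = h u" "u \<in> Q <+> {1..l + n}" for x u
    using that
  proof (induction arbitrary: u rule: resolves.induct)
    case (position q)
    moreover from this have "u \<notin> Inr ` {1..l}" using E(1) by fastforce
    moreover have "resolves l n' E' (Inl q) (Inl q)" by simp
    ultimately show ?case using outside by metis
  next
    case (exit i)
    moreover from this have "u \<notin> Inr ` {1..l}" using E(1) by fastforce
    moreover have "resolves l n' E' (Inr (i + l)) (Inr i)" using exit(1) by (rule resolves.exit)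
    ultimately show ?case using outside by metis
  next
    case (feedback j t)
    \<comment> \<open>The map \<open>h\<close> is not assumed injective: an untraced target might
      also be sent to the wire \<open>j\<close>.\<close>
    show ?case
    proof (cases "u \<in> Inr ` {1..l}")
      case True
      then have "u = Inr j" using E(1) feedback.prems(1) by fastforce
      then show ?thesis
        using feedback.IH[of "E j"] feedback.hyps(1) E(2) range by (auto simp: resolves_feedback_iff)
    next
      case False
      moreover have "resolves l n' E' (Inr j) t"
        using feedback.hyps by (rule resolves.feedback)
      ultimately show ?thesis using outside feedback.prems by metis
    qed
  qed
  then show "resolves l n' E' (h u) t \<Longrightarrow> (resolves l n E OO (\<lambda>v t. t = h' v)) u t"
    using u by auto
qed

text \<open>The large loop is cut at its visits to wires beyond \<open>l1\<close>. These are exits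
  of the inner loop and are fed back by the outer one; \<open>trace_entry\<close> condenses the
  stretch after each visit into one step.\<close>

lemma resolves_trace:
  assumes A: "A \<in> roMDP (l1 + (l2 + m)) (l1 + (l2 + n))"
  shows "resolves (l1 + l2) n (entry A) u t \<longleftrightarrow>
    (resolves l1 (l2 + n) (entry A) OO resolves l2 n (trace_entry l1 (l2 + n) A)) u t"
proof
  let ?E = "trace_entry l1 (l2 + n) A"
  have step: "resolves l1 (l2 + n) (entry A) (entry A (j + l1)) v \<longleftrightarrow> v = ?E j" if "j \<in> {1..l2}" for j v
    using trace_entry_resolves[OF A, of j] that by simp
  show "(resolves l1 (l2 + n) (entry A) OO resolves l2 n ?E) u t"
    if "resolves (l1 + l2) n (entry A) u t"
    using that
  proof (induction rule: resolves.induct)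
    case (position q)
    then show ?case by auto
  next
    case (exit t)
    then have "resolves l1 (l2 + n) (entry A) (Inr ((t + l2) + l1)) (Inr (t + l2))"
      by (intro resolves.exit) auto
    moreover have "resolves l2 n ?E (Inr (t + l2)) (Inr t)" using exit by (rule resolves.exit)
    ultimately show ?case by (auto simp: ac_simps)
  next
    case (feedback j t)
    then obtain v where v: "resolves l1 (l2 + n) (entry A) (entry A j) v" "resolves l2 n ?E v t"
      by blast
    show ?case
    proof (cases "j \<le> l1")
      case True
      then have "resolves l1 (l2 + n) (entry A) (Inr j) v"
        using feedback(1) v(1) by (intro resolves.feedback) auto
      with v(2) show ?thesis by blast
    next
      case False
      define i where "i = j - l1"
      have i: "j = i + l1" "i \<in> {1..l2}" using False feedback(1) by (auto simp: i_def)
      have "v = ?E i" using step[OF i(2), of v] v(1) i by simp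
      then have "resolves l2 n ?E (Inr i) t" using v(2) i(2) by (simp add: resolves_feedback_iff)
      moreover have "resolves l1 (l2 + n) (entry A) (Inr j) (Inr i)"
        unfolding i using i(2) by (intro resolves.exit) auto
      ultimately show ?thesis by blast
    qed
  qed
  \<comment> \<open>The induction runs over the outer loop. Each of its cases needs another
    induction, over the stretch of the inner loop from \<open>u\<close> to \<open>v\<close>.\<close>
  have "resolves (l1 + l2) n (entry A) u t"
    if "resolves l2 n ?E v t" "resolves l1 (l2 + n) (entry A) u v" for u v
    using that
  proof (induction arbitrary: u rule: resolves.induct)
    case (position q)
    then show ?case
      by (induction u "Inl q :: 'a + nat" rule: resolves.induct) (auto intro: resolves.intros)
  next
    case (exit t)
    from exit(2,1) show ?case
    proof (induction u "Inr (t + l2) :: 'a + nat" rule: resolves.induct)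
      case exit
      then show ?case using resolves.exit[of t n "l1 + l2" "entry A"] by (simp add: ac_simps)
    qed (auto intro: resolves.feedback)
  next
    case (feedback j t)
    have "resolves (l1 + l2) n (entry A) (entry A (j + l1)) t"
      using feedback.IH step[OF feedback.hyps(1)] by blast
    then have base: "resolves (l1 + l2) n (entry A) (Inr (j + l1)) t"
      using feedback.hyps(1) by (intro resolves.feedback) auto
    from feedback.prems show ?case
      by (induction u "Inr j :: 'a + nat" rule: resolves.induct) (auto intro: base resolves.feedback)
  qed
  then show "(resolves l1 (l2 + n) (entry A) OO resolves l2 n ?E) u t \<Longrightarrow>
      resolves (l1 + l2) n (entry A) u t" by blast
qed

text \<open>Both loops alternate between \<open>E_A\<close> and \<open>E_B\<close>: the first one, \<open>E_C\<close>, is cut in front of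
  \<open>E_B\<close> and the second one, \<open>E_D\<close>, in front of \<open>E_A\<close>.\<close>
lemma resolves_dinatural:
  fixes f :: "'c \<Rightarrow> 'd"
  assumes E_B: "\<And>j. j \<in> {1..l} \<Longrightarrow> E_B j \<in> Q_B <+> {1..k}"
    and E_A: "\<And>i. i \<in> {1..k} \<Longrightarrow> E_A i \<in> Q_A <+> {1..l + n}"
    and E_C: "\<And>j. j \<in> {1..l} \<Longrightarrow> E_C j = case_sum (\<lambda>q. Inl (b q)) (\<lambda>i. map_sum a id (E_A i)) (E_B j)"
    and E_D: "\<And>i. i \<in> {1..k} \<Longrightarrow> E_D i = h (E_A i)"
    and h: "\<And>p. h (Inl p) = Inl (f (a p))" "\<And>i. i \<in> {1..n} \<Longrightarrow> h (Inr (i + l)) = Inr (i + k)"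
      "\<And>j. j \<in> {1..l} \<Longrightarrow> h (Inr j) = map_sum (\<lambda>q. f (b q)) id (E_B j)"
    and u: "u \<in> Q_A <+> {1..l + n}"
  shows "resolves k n E_D (h u) t' \<longleftrightarrow>
    (\<exists>t. resolves l n E_C (map_sum a id u) t \<and> t' = map_sum f id t)"
proof
  have "resolves k n E_D (h u) (map_sum f id t)"
    if "resolves l n E_C x t" "x = map_sum a id u" "u \<in> Q_A <+> {1..l + n}" for x t u
    using that
  proof (induction arbitrary: u rule: resolves.induct)
    case (position p)
    then show ?case using h(1) by (cases u) auto
  next
    case (exit t)
    then have "u = Inr (t + l)" by (cases u) auto
    then show ?case using exit h(2) by (auto intro: resolves.exit)
  next
    case (feedback j t)
    then have u: "u = Inr j" by (cases u) auto
    show ?case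
    proof (cases "E_B j")
      case (Inl q)
      then show ?thesis using feedback.hyps E_C[of j] h(3)[of j] u by simp
    next
      case (Inr i)
      then have i: "i \<in> {1..k}" using E_B[OF feedback.hyps(1)] by auto
      \<comment> \<open>A turn of the first loop from \<open>j\<close> through \<open>E_B\<close>
        and \<open>E_A\<close> corresponds to the feedback step of the second loop at the wire
        \<open>i\<close> in between.\<close>
      then have "resolves k n E_D (h (E_A i)) (map_sum f id t)"
        using feedback.hyps(1) E_C[of j] E_A[of i] Inr by (intro feedback.IH) auto
      then have "resolves k n E_D (Inr i) (map_sum f id t)"
        unfolding E_D[OF i, symmetric] by (rule resolves.feedback[OF i])
      moreover have "h u = Inr i" using h(3)[OF feedback.hyps(1)] u Inr by simp
      ultimately show ?thesis by (simp add: id_def)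
    qed
  qed
  then show "\<exists>t. resolves l n E_C (map_sum a id u) t \<and> t' = map_sum f id t \<Longrightarrow> resolves k n E_D (h u) t'"
    using u by blast
  \<comment> \<open>Unless \<open>u\<close> is a traced wire that \<open>E_B\<close> sends to a
    wire, the second loop is left at \<open>h u\<close> and the first one after at most one
    step.\<close>
  have outside: "\<exists>t. resolves l n E_C (map_sum a id u) t \<and> t' = map_sum f id t"
    if t': "resolves k n E_D (h u) t'" and u: "u \<in> Q_A <+> {1..l + n}"
      and not_fed: "\<not> (\<exists>j\<in>{1..l}. u = Inr j \<and> (\<exists>i. E_B j = Inr i))" for u t'
  proof (cases u)
    case (Inl p)
    then show ?thesis using t' h(1) by simp
  next
    case (Inr j)
    show ?thesis
    proof (cases "j \<le> l")
      case True
      then have j: "j \<in> {1..l}" using u Inr by auto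
      then obtain q where "E_B j = Inl q" using not_fed Inr by (cases "E_B j") auto
      then show ?thesis using t' Inr j E_C[OF j] h(3)[OF j] by (simp add: resolves_feedback_iff)
    next
      case False
      define i where "i = j - l"
      have i: "j = i + l" "i \<in> {1..n}" using False u Inr by (auto simp: i_def)
      then show ?thesis using t' h(2)[OF i(2)] Inr by simp
    qed
  qed
  have "\<exists>t. resolves l n E_C (map_sum a id u) t \<and> t' = map_sum f id t"
    if "resolves k n E_D x t'" "x = h u" "u \<in> Q_A <+> {1..l + n}" for x u
    using that
  proof (induction arbitrary: u rule: resolves.induct)
    case (position q)
    have "\<not> (\<exists>j\<in>{1..l}. u = Inr j \<and> (\<exists>i. E_B j = Inr i))" using position(1) h(3) by auto
    then show ?case using outside position by (metis resolves.position)
  next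
    case (exit t)
    have "\<not> (\<exists>j\<in>{1..l}. u = Inr j \<and> (\<exists>i. E_B j = Inr i))"
    proof (clarify)
      fix j i assume j: "j \<in> {1..l}" "u = Inr j" "E_B j = Inr i"
      then have "i \<in> {1..k}" using E_B[OF j(1)] by auto
      then show False using exit(1,2) h(3)[OF j(1)] j by simp
    qed
    then show ?case using outside exit by (metis resolves.exit)
  next
    case (feedback i t)
    show ?case
    proof (cases "\<exists>j\<in>{1..l}. u = Inr j \<and> (\<exists>i. E_B j = Inr i)")
      case True
      then obtain j where j: "j \<in> {1..l}" "u = Inr j" "E_B j = Inr i"
        using feedback.prems(1) h(3) by auto
      have "\<exists>v. resolves l n E_C (map_sum a id (E_A i)) v \<and> t = map_sum f id v"
        using feedback.hyps(1) E_D E_A by (intro feedback.IH) auto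
      then show ?thesis using j E_C[OF j(1)] by (simp add: resolves_feedback_iff id_def)
    next
      case False
      moreover have "resolves k n E_D (Inr i) t" using feedback.hyps by (rule resolves.feedback)
      ultimately show ?thesis using outside feedback.prems by metis
    qed
  qed
  then show "resolves k n E_D (h u) t' \<Longrightarrow>
      \<exists>t. resolves l n E_C (map_sum a id u) t \<and> t' = map_sum f id t"
    using u by blast
qed

subsection \<open>The equations\<close>

text \<open>The composite of \<open>R\<close> with the renaming can hit
  \<open>map_sum f id t\<close> only through \<open>t\<close>, as \<open>R\<close> stays within the
  targets and \<open>f\<close> is injective. So it suffices to compare composites of
  relations.\<close>

lemma same_weightI:
  assumes inj: "inj_on f (positions A)" and flA: "flow A x D R w" and flB: "flow B y D R' w"
    and R: "\<And>u t. u \<in> D \<Longrightarrow> R' u t \<longleftrightarrow> (R OO (\<lambda>v t. t = map_sum f id v)) u t"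
  shows "same_weight A x B y f"
proof (rule same_weight_flowI[OF flA flB])
  fix u t assume u: "u \<in> D" and t: "t \<in> targets A"
  have "v = t" if "R u v" "map_sum f id t = map_sum f id v" for v
  proof -
    have "v \<in> targets A" using flA u that(1) unfolding flow_def wiring_def by blast
    then show ?thesis using that(2) t inj by (cases v; cases t) (auto simp: inj_on_def)
  qed
  then show "R u t \<longleftrightarrow> R' u (map_sum f id t)" using R[OF u] by blast
qed

lemma same_weight_entryI:
  assumes "A \<in> roMDP m n" "B \<in> roMDP m n" "inj_on f (positions A)" "i \<in> {1..m}"
    "entry B i = map_sum f id (entry A i)"
  shows "same_weight A (Inl i) B (Inl i) f"
  by (rule same_weightI[OF assms(3) flow_entry[OF assms(1,4)] flow_entry[OF assms(2,4)]])
    (auto simp: assms(5))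

lemma romdp_iso_no_positions:
  assumes "A \<in> roMDP m n" "B \<in> roMDP m n" "positions A = {}" "positions B = {}"
    and "\<And>i. i \<in> {1..m} \<Longrightarrow> entry A i = Inr (g i)" "\<And>i. i \<in> {1..m} \<Longrightarrow> entry B i = Inr (g i)"
  shows "A \<cong>\<^bsub>m,n\<^esub> B"
  using assms unfolding romdp_iso_def by (auto simp: bij_betw_def)

lemma bij_betw_witness:
  assumes "\<And>a. a \<in> S \<Longrightarrow> f a \<in> T \<and> g (f a) = a" "\<And>b. b \<in> T \<Longrightarrow> g b \<in> S \<and> f (g b) = b"
  shows "bij_betw f S T"
  using assms by (intro bij_betw_byWitness[where f' = g]) auto

lemmas flow_seq_comp_left_position =
  flow_seq_comp_left[where x = "Inr (p, a)" for p a, unfolded lift_simps sources_simps fst_conv]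
lemmas flow_oplus_left_position =
  flow_oplus_left[where x = "Inr (p, a)" for p a, unfolded lift_simps sources_simps fst_conv]
lemmas flow_oplus_right_position =
  flow_oplus_right[where x = "Inr (p, a)" for p a, unfolded lift_simps sources_simps fst_conv]

section \<open>Units, associativity and bifunctoriality\<close>

lemma ident_seq_comp_iso:
  fixes A :: "('p, 'a::finite) romdp"
  assumes A: "A \<in> roMDP m n"
  shows "((\<I> m :: ('i, 'a) romdp) \<Zcomp> A) \<cong>\<^bsub>m,n\<^esub> A"
proof (rule romdp_isoI[where f = projr])
  let ?L = "(\<I> m :: ('i, 'a) romdp) \<Zcomp> A"
  show L: "?L \<in> roMDP m n" by (rule seq_comp_roMDP[OF ident_roMDP A])
  \<comment> \<open>A projection is a bijection here because the identity has no positions; the same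
    device removes the identities in the naturality and dinaturality equations.\<close>
  show f: "bij_betw projr (positions ?L) (positions A)"
    by (rule bij_betw_witness[where g = Inr]) auto
  note inj = bij_betw_imp_inj_on[OF f]
  show "reward A (projr s) = reward ?L s" if "s \<in> positions ?L" for s using that by auto
  fix x assume "x \<in> sources ?L"
  then show "same_weight ?L x A (map_sum id (map_prod projr id) x) projr"
  proof (cases rule: sources_seq_comp_cases)
    case (left y)
    then obtain i where i: "y = Inl i" "i \<in> {1..m}" by (cases y) auto
    have "entry A i = map_sum projr id (entry ?L i)" by (cases "entry A i") auto
    then show ?thesis using same_weight_entryI[OF L A inj i(2)] by (simp add: left i)
  next
    case (right q a)
    note fl = flow_refl[OF A, of "Inr (q, a)"]
    have "same_weight ?L (Inr (Inr q, a)) A (Inr (q, a)) projr"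
    proof (rule same_weightI[OF inj flow_seq_comp_right[OF ident_roMDP A right(1) fl] fl])
      fix u t show "u = t \<longleftrightarrow> (((=) OO (\<lambda>u v. v = map_sum Inr id u)) OO
          (\<lambda>v t. t = map_sum projr id v)) u t" by (cases u) auto
    qed
    then show ?thesis by (simp add: right)
  qed
qed (rule A)

lemma seq_comp_ident_iso:
  fixes A :: "('p, 'a::finite) romdp"
  assumes A: "A \<in> roMDP m n"
  shows "A \<cong>\<^bsub>m,n\<^esub> (A \<Zcomp> (\<I> n :: ('i, 'a) romdp))"
proof (rule romdp_isoI[where f = Inl])
  let ?R = "A \<Zcomp> (\<I> n :: ('i, 'a) romdp)"
  show "?R \<in> roMDP m n" by (rule seq_comp_roMDP[OF A ident_roMDP])
  show f: "bij_betw Inl (positions A) (positions ?R)"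
    by (rule bij_betw_witness[where g = projl]) auto
  note inj = bij_betw_imp_inj_on[OF f]
  show "reward ?R (Inl s) = reward A s" for s by simp
  fix x assume x: "x \<in> sources A"
  have "same_weight A x ?R (lift_left x) Inl"
  proof (rule same_weightI[OF inj flow_refl[OF A] flow_seq_comp_left[OF A ident_roMDP x flow_refl[OF A]]])
    fix u :: "'p + nat" and t show "((=) OO (\<lambda>u v. v = then_entry (\<I> n :: ('i, 'a) romdp) u)) u t \<longleftrightarrow>
        ((=) OO (\<lambda>v t. t = map_sum Inl id v)) u t" by (cases u) auto
  qed
  then show "same_weight A x ?R (map_sum id (map_prod Inl id) x) Inl" by (simp add: lift_left_def)
qed (rule A)

lemma seq_comp_assoc_iso:
  fixes A :: "('p, 'a::finite) romdp" and B :: "('q, 'a) romdp" and C :: "('r, 'a) romdp"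
  assumes A: "A \<in> roMDP m n" and B: "B \<in> roMDP n k" and C: "C \<in> roMDP k l"
  shows "(A \<Zcomp> (B \<Zcomp> C)) \<cong>\<^bsub>m,l\<^esub> ((A \<Zcomp> B) \<Zcomp> C)"
proof (rule romdp_isoI)
  let ?L = "A \<Zcomp> (B \<Zcomp> C)" and ?R = "(A \<Zcomp> B) \<Zcomp> C"
  let ?f = "case_sum (Inl \<circ> Inl) (case_sum (Inl \<circ> Inr) Inr) :: 'p + 'q + 'r \<Rightarrow> ('p + 'q) + 'r"
  note AB = seq_comp_roMDP[OF A B] and BC = seq_comp_roMDP[OF B C]
  show "?L \<in> roMDP m l" "?R \<in> roMDP m l"
    by (rule seq_comp_roMDP[OF A BC], rule seq_comp_roMDP[OF AB C])
  show f: "bij_betw ?f (positions ?L) (positions ?R)"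
    by (rule bij_betw_witness[where g = "case_sum (case_sum Inl (Inr \<circ> Inl)) (Inr \<circ> Inr)"]) auto
  note inj = bij_betw_imp_inj_on[OF f]
  show "reward ?R (?f s) = reward ?L s" for s by (auto split: sum.splits)
  fix x assume "x \<in> sources ?L"
  then show "same_weight ?L x ?R (map_sum id (map_prod ?f id) x) ?f"
  proof (cases rule: sources_seq_comp_cases)
    case (left y)
    have "lift_left y \<in> sources (A \<Zcomp> B)" using left(1) by (cases y) auto
    note flR = flow_seq_comp_left[OF AB C this flow_seq_comp_left[OF A B left(1) flow_refl[OF A]]]
    have "then_entry C (then_entry B u) = map_sum ?f id (then_entry (B \<Zcomp> C) u)" for u :: "'p + nat"
    proof (cases u)
      case (Inr j)
      then show ?thesis
        by (cases "entry B j"; cases "entry C (projr (entry B j))") auto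
    qed simp
    then have "same_weight ?L (lift_left y) ?R (lift_left (lift_left y)) ?f"
      by (intro same_weightI[OF inj flow_seq_comp_left[OF A BC left(1) flow_refl[OF A]] flR]) auto
    moreover have "map_sum id (map_prod ?f id) (lift_left y) = lift_left (lift_left y)"
      by (cases y) auto
    ultimately show ?thesis by (simp add: left)
  next
    case (right s a)
    then show ?thesis
    proof (cases s)
      case (Inl q)
      then have q: "q \<in> positions B" "Inr q \<in> positions (A \<Zcomp> B)" using right by auto
      note fl = flow_refl[OF B, of "Inr (q, a)"]
      note flL = flow_seq_comp_right[OF A BC right(1), unfolded Inl,
          OF flow_seq_comp_left_position[OF B C q(1) fl]]
      note flR = flow_seq_comp_left_position[OF AB C q(2) flow_seq_comp_right[OF A B q(1) fl]]
      have "then_entry C (map_sum Inr id u) = map_sum ?f id (map_sum Inr id (then_entry C u))"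
        for u :: "'q + nat"
      proof (cases u)
        case (Inr j)
        then show ?thesis by (cases "entry C j") auto
      qed simp
      then have "same_weight ?L (Inr (Inr (Inl q), a)) ?R (Inr (Inl (Inr q), a)) ?f"
        by (intro same_weightI[OF inj flL flR]) auto
      then show ?thesis by (simp add: right Inl)
    next
      case (Inr r)
      then have r: "r \<in> positions C" using right by auto
      note fl = flow_refl[OF C, of "Inr (r, a)"]
      note flL = flow_seq_comp_right[OF A BC right(1), unfolded Inr, OF flow_seq_comp_right[OF B C r fl]]
      note flR = flow_seq_comp_right[OF AB C r fl]
      have "map_sum Inr id u = map_sum ?f id (map_sum Inr id (map_sum Inr id u))" for u :: "'r + nat"
        by (cases u) auto
      then have "same_weight ?L (Inr (Inr (Inr r), a)) ?R (Inr (Inr r, a)) ?f"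
        by (intro same_weightI[OF inj flL flR]) auto
      then show ?thesis by (simp add: right Inr)
    qed
  qed
qed

lemma oplus_assoc_iso:
  fixes A :: "('p, 'a::finite) romdp" and B :: "('q, 'a) romdp" and C :: "('r, 'a) romdp"
  assumes A: "A \<in> roMDP m1 n1" and B: "B \<in> roMDP m2 n2" and C: "C \<in> roMDP m3 n3"
  shows "((A \<oplus> B) \<oplus> C) \<cong>\<^bsub>m1 + m2 + m3,n1 + n2 + n3\<^esub> (A \<oplus> (B \<oplus> C))"
proof (rule romdp_isoI)
  let ?L = "(A \<oplus> B) \<oplus> C" and ?R = "A \<oplus> (B \<oplus> C)"
  let ?f = "case_sum (case_sum Inl (Inr \<circ> Inl)) (Inr \<circ> Inr) :: ('p + 'q) + 'r \<Rightarrow> 'p + 'q + 'r"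
  note AB = oplus_roMDP[OF A B] and BC = oplus_roMDP[OF B C]
  show "?L \<in> roMDP (m1 + m2 + m3) (n1 + n2 + n3)" by (rule oplus_roMDP[OF AB C])
  show "?R \<in> roMDP (m1 + m2 + m3) (n1 + n2 + n3)"
    using oplus_roMDP[OF A BC] by (simp add: add.assoc)
  show f: "bij_betw ?f (positions ?L) (positions ?R)"
    by (rule bij_betw_witness[where g = "case_sum (Inl \<circ> Inl) (case_sum (Inl \<circ> Inr) Inr)"]) auto
  note inj = bij_betw_imp_inj_on[OF f]
  show "reward ?R (?f s) = reward ?L s" for s by (auto split: sum.splits)
  fix x assume "x \<in> sources ?L"
  from this roMDP_D(1)[OF AB]
  show "same_weight ?L x ?R (map_sum id (map_prod ?f id) x) ?f"
  proof (cases rule: sources_oplus_cases)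
    case (left y)
    from left(1) roMDP_D(1)[OF A] show ?thesis
    proof (cases rule: sources_oplus_cases)
      case l: (left z)
      note fl = flow_refl[OF A, of z]
      note flL = flow_oplus_left[OF AB C left(1)[unfolded l(2)] flow_oplus_left[OF A B l(1) fl]]
      note flR = flow_oplus_left[OF A BC l(1) fl]
      have "map_sum Inl id u = map_sum ?f id (map_sum Inl id (map_sum Inl id u))" for u :: "'p + nat"
        by (cases u) auto
      then have "same_weight ?L (lift_left (lift_left z)) ?R (lift_left z) ?f"
        by (intro same_weightI[OF inj flL flR]) auto
      moreover have "map_sum id (map_prod ?f id) (lift_left (lift_left z)) = lift_left z"
        by (cases z) auto
      ultimately show ?thesis by (simp add: left l)
    next
      case r: (right z)
      have "lift_left z \<in> sources (B \<oplus> C)" using r(1) by (cases z) auto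
      note fl = flow_refl[OF B, of z]
      note flL = flow_oplus_left[OF AB C left(1)[unfolded r(2)] flow_oplus_right[OF A B r(1) fl]]
      note flR = flow_oplus_right[OF A BC \<open>lift_left z \<in> _\<close> flow_oplus_left[OF B C r(1) fl]]
      have "map_sum Inr (\<lambda>t. t + n1) (map_sum Inl id u)
          = map_sum ?f id (map_sum Inl id (map_sum Inr (\<lambda>t. t + n1) u))" for u :: "'q + nat"
        by (cases u) auto
      then have "same_weight ?L (lift_left (lift_right m1 z)) ?R (lift_right m1 (lift_left z)) ?f"
        by (intro same_weightI[OF inj flL flR]) auto
      moreover have "map_sum id (map_prod ?f id) (lift_left (lift_right m1 z)) = lift_right m1 (lift_left z)"
        by (cases z) auto
      ultimately show ?thesis by (simp add: left r)
    qed
  next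
    case (right z)
    have "lift_right m2 z \<in> sources (B \<oplus> C)" using right(1) roMDP_D(1)[OF B] by (cases z) auto
    note fl = flow_refl[OF C, of z]
    note flL = flow_oplus_right[OF AB C right(1) fl]
    note flR = flow_oplus_right[OF A BC \<open>lift_right m2 z \<in> _\<close> flow_oplus_right[OF B C right(1) fl]]
    have "map_sum Inr (\<lambda>t. t + n1) (map_sum Inr (\<lambda>t. t + n2) u)
        = map_sum ?f id (map_sum Inr (\<lambda>t. t + (n1 + n2)) u)" for u :: "'r + nat"
      by (cases u) auto
    then have "same_weight ?L (lift_right (m1 + m2) z) ?R (lift_right m1 (lift_right m2 z)) ?f"
      by (intro same_weightI[OF inj flL flR]) auto
    moreover have "map_sum id (map_prod ?f id) (lift_right (m1 + m2) z) = lift_right m1 (lift_right m2 z)"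
      by (cases z) auto
    ultimately show ?thesis by (simp add: right)
  qed
qed

lemma oplus_seq_comp_iso:
  fixes A :: "('p, 'a::finite) romdp" and B :: "('q, 'a) romdp" and C :: "('r, 'a) romdp"
    and D :: "('s, 'a) romdp"
  assumes A: "A \<in> roMDP m1 k1" and B: "B \<in> roMDP m2 k2" and C: "C \<in> roMDP k1 n1"
    and D: "D \<in> roMDP k2 n2"
  shows "((A \<oplus> B) \<Zcomp> (C \<oplus> D)) \<cong>\<^bsub>m1 + m2,n1 + n2\<^esub> ((A \<Zcomp> C) \<oplus> (B \<Zcomp> D))"
proof (rule romdp_isoI)
  let ?L = "(A \<oplus> B) \<Zcomp> (C \<oplus> D)" and ?R = "(A \<Zcomp> C) \<oplus> (B \<Zcomp> D)"
  let ?f = "case_sum (map_sum Inl Inl) (map_sum Inr Inr) :: ('p + 'q) + ('r + 's) \<Rightarrow> ('p + 'r) + ('q + 's)"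
  note AB = oplus_roMDP[OF A B] and CD = oplus_roMDP[OF C D]
    and AC = seq_comp_roMDP[OF A C] and BD = seq_comp_roMDP[OF B D]
  show "?L \<in> roMDP (m1 + m2) (n1 + n2)" by (rule seq_comp_roMDP[OF AB CD])
  show "?R \<in> roMDP (m1 + m2) (n1 + n2)" by (rule oplus_roMDP[OF AC BD])
  show f: "bij_betw ?f (positions ?L) (positions ?R)"
    by (rule bij_betw_witness[where g = "case_sum (map_sum Inl Inl) (map_sum Inr Inr)"]) auto
  note inj = bij_betw_imp_inj_on[OF f]
  show "reward ?R (?f s) = reward ?L s" for s by (auto split: sum.splits)
  fix x assume "x \<in> sources ?L"
  then show "same_weight ?L x ?R (map_sum id (map_prod ?f id) x) ?f"
  proof (cases rule: sources_seq_comp_cases)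
    case (left y)
    from left(1) roMDP_D(1)[OF A] show ?thesis
    proof (cases rule: sources_oplus_cases)
      case l: (left z)
      have "lift_left z \<in> sources (A \<Zcomp> C)" using l(1) by (cases z) auto
      note fl = flow_refl[OF A, of z]
      note flL = flow_seq_comp_left[OF AB CD left(1)[unfolded l(2)] flow_oplus_left[OF A B l(1) fl]]
      note flR = flow_oplus_left[OF AC BD \<open>lift_left z \<in> _\<close> flow_seq_comp_left[OF A C l(1) fl]]
      \<comment> \<open>An exit among the targets of \<open>A\<close> is at most \<open>k1\<close>,
        hence it meets an entrance of \<open>C\<close> and not of \<open>D\<close>.\<close>
      have "map_sum Inl id (then_entry C u) = map_sum ?f id (then_entry (C \<oplus> D) (map_sum Inl id u))"
        if "u \<in> targets A" for u
      proof (cases u)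
        case (Inr j)
        then show ?thesis using that roMDP_D(2)[OF A] roMDP_D(1)[OF C] by (cases "entry C j") auto
      qed simp
      then have "same_weight ?L (lift_left (lift_left z)) ?R (lift_left (lift_left z)) ?f"
        by (intro same_weightI[OF inj flL flR]) auto
      moreover have "map_sum id (map_prod ?f id) (lift_left (lift_left z)) = lift_left (lift_left z)"
        by (cases z) auto
      ultimately show ?thesis by (simp add: left l)
    next
      case r: (right z)
      have "lift_left z \<in> sources (B \<Zcomp> D)" using r(1) by (cases z) auto
      note fl = flow_refl[OF B, of z]
      note flL = flow_seq_comp_left[OF AB CD left(1)[unfolded r(2)] flow_oplus_right[OF A B r(1) fl]]
      note flR = flow_oplus_right[OF AC BD \<open>lift_left z \<in> _\<close> flow_seq_comp_left[OF B D r(1) fl]]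
      have "map_sum Inr (\<lambda>t. t + n1) (then_entry D u)
          = map_sum ?f id (then_entry (C \<oplus> D) (map_sum Inr (\<lambda>t. t + k1) u))"
        if "u \<in> targets B" for u
      proof (cases u)
        case (Inr j)
        then have "entry (C \<oplus> D) (j + k1) = map_sum Inr (\<lambda>t. t + n1) (entry D j)"
          using that roMDP_D(1,2)[OF C] oplus_simps(6)[of j C D] by simp
        then show ?thesis using Inr by (cases "entry D j") auto
      qed simp
      then have "same_weight ?L (lift_left (lift_right m1 z)) ?R (lift_right m1 (lift_left z)) ?f"
        by (intro same_weightI[OF inj flL flR]) auto
      moreover have "map_sum id (map_prod ?f id) (lift_left (lift_right m1 z)) = lift_right m1 (lift_left z)"
        by (cases z) auto
      ultimately show ?thesis by (simp add: left r)
    qed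
  next
    case (right s a)
    show ?thesis
    proof (cases s)
      case (Inl r)
      then have r: "r \<in> positions C" "Inr r \<in> positions (A \<Zcomp> C)" using right by auto
      note fl = flow_refl[OF C, of "Inr (r, a)"]
      note flL = flow_seq_comp_right[OF AB CD right(1)[unfolded Inl] flow_oplus_left_position[OF C D r(1) fl]]
      note flR = flow_oplus_left_position[OF AC BD r(2) flow_seq_comp_right[OF A C r(1) fl]]
      have "map_sum Inl id (map_sum Inr id u) = map_sum ?f id (map_sum Inr id (map_sum Inl id u))"
        for u :: "'r + nat" by (cases u) auto
      then have "same_weight ?L (Inr (Inr (Inl r), a)) ?R (Inr (Inl (Inr r), a)) ?f"
        by (intro same_weightI[OF inj flL flR]) auto
      then show ?thesis by (simp add: right Inl)
    next
      case (Inr q)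
      then have q: "q \<in> positions D" "Inr q \<in> positions (B \<Zcomp> D)" using right by auto
      note fl = flow_refl[OF D, of "Inr (q, a)"]
      note flL = flow_seq_comp_right[OF AB CD right(1)[unfolded Inr] flow_oplus_right_position[OF C D q(1) fl]]
      note flR = flow_oplus_right_position[OF AC BD q(2) flow_seq_comp_right[OF B D q(1) fl]]
      have "map_sum Inr (\<lambda>t. t + n1) (map_sum Inr id u)
          = map_sum ?f id (map_sum Inr id (map_sum Inr (\<lambda>t. t + n1) u))"
        for u :: "'s + nat" by (cases u) auto
      then have "same_weight ?L (Inr (Inr (Inr q), a)) ?R (Inr (Inr (Inr q), a)) ?f"
        by (intro same_weightI[OF inj flL flR]) auto
      then show ?thesis by (simp add: right Inr)
    qed
  qed
qed

section \<open>Equations between systems without positions\<close>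

lemma ident_oplus_iso:
  "((\<I> m :: ('i, 'a::finite) romdp) \<oplus> (\<I> n :: ('j, 'a) romdp))
    \<cong>\<^bsub>m + n,m + n\<^esub> (\<I> (m + n) :: ('k, 'a) romdp)"
  by (rule romdp_iso_no_positions[where g = "\<lambda>i. i", OF oplus_roMDP[OF ident_roMDP ident_roMDP] ident_roMDP])
    (auto simp: oplus_def)

lemma swap_0_iso: "(\<S> m 0 :: ('i, 'a::finite) romdp) \<cong>\<^bsub>m,m\<^esub> (\<I> m :: ('j, 'a) romdp)"
proof (rule romdp_iso_no_positions[where g = "\<lambda>i. i"])
  show "(\<S> m 0 :: ('i, 'a) romdp) \<in> roMDP m m" using swap_roMDP[of m 0] by simp
qed (simp_all add: ident_roMDP)

lemma swap_hexagon_iso: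
  "(\<S> l (m + n) :: ('g, 'a::finite) romdp) \<cong>\<^bsub>l + m + n,m + n + l\<^esub>
    (((\<S> l m :: ('h, 'a) romdp) \<oplus> (\<I> n :: ('i, 'a) romdp)) \<Zcomp>
     ((\<I> m :: ('j, 'a) romdp) \<oplus> (\<S> l n :: ('k, 'a) romdp)))"
proof (rule romdp_iso_no_positions[where g = "\<lambda>i. if i \<le> l then i + (m + n) else i - l"])
  show "(\<S> l (m + n) :: ('g, 'a) romdp) \<in> roMDP (l + m + n) (m + n + l)"
    using swap_roMDP[of l "m + n"] by (simp add: add.assoc)
  have "(\<I> m :: ('j, 'a) romdp) \<oplus> (\<S> l n :: ('k, 'a) romdp) \<in> roMDP (m + l + n) (m + n + l)"
    using oplus_roMDP[OF ident_roMDP swap_roMDP, of m l n] by (simp add: add.assoc)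
  then show "((\<S> l m :: ('h, 'a) romdp) \<oplus> (\<I> n :: ('i, 'a) romdp)) \<Zcomp>
      ((\<I> m :: ('j, 'a) romdp) \<oplus> (\<S> l n :: ('k, 'a) romdp)) \<in> roMDP (l + m + n) (m + n + l)"
    by (rule seq_comp_roMDP[OF oplus_roMDP[OF swap_roMDP ident_roMDP]])
qed (auto simp: oplus_def)

lemma swap_swap_iso:
  "((\<S> m n :: ('i, 'a::finite) romdp) \<Zcomp> (\<S> n m :: ('j, 'a) romdp))
    \<cong>\<^bsub>m + n,m + n\<^esub> (\<I> (m + n) :: ('k, 'a) romdp)"
  by (rule romdp_iso_no_positions[where g = "\<lambda>i. i", OF seq_comp_roMDP[OF swap_roMDP swap_roMDP] ident_roMDP])
    auto

lemma trace_ident_iso: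
  "trace 0 m m (\<I> m :: ('i, 'a::finite) romdp) \<cong>\<^bsub>m,m\<^esub> (\<I> m :: ('j, 'a) romdp)"
proof (rule romdp_iso_no_positions[where g = "\<lambda>i. i"])
  have I: "(\<I> m :: ('i, 'a) romdp) \<in> roMDP (0 + m) (0 + m)" using ident_roMDP by simp
  show "trace 0 m m (\<I> m :: ('i, 'a) romdp) \<in> roMDP m m" by (rule trace_roMDP[OF I])
  show "entry (trace 0 m m (\<I> m :: ('i, 'a) romdp)) i = Inr i" if "i \<in> {1..m}" for i
    using trace_entry_eqI[OF I that, of "Inr i"] that resolves.exit[of i m 0 "entry (\<I> m :: ('i, 'a) romdp)"]
    by simp
qed (simp_all add: ident_roMDP)

text \<open>One feedback step: the untraced entrance \<open>i\<close> leads to the traced exit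
  \<open>i\<close>, and the entrance \<open>i\<close> leads on to the untraced exit
  \<open>i + m\<close>.\<close>

lemma trace_swap_iso:
  "trace m m m (\<S> m m :: ('i, 'a::finite) romdp) \<cong>\<^bsub>m,m\<^esub> (\<I> m :: ('j, 'a) romdp)"
proof (rule romdp_iso_no_positions[where g = "\<lambda>i. i"])
  let ?S = "\<S> m m :: ('i, 'a) romdp"
  show "trace m m m ?S \<in> roMDP m m" by (rule trace_roMDP[OF swap_roMDP])
  show "entry (trace m m m ?S) i = Inr i" if i: "i \<in> {1..m}" for i
    using trace_entry_eqI[OF swap_roMDP i, of "Inr i :: 'i + nat"] i
    by (simp add: resolves_feedback_iff)
qed (simp_all add: ident_roMDP)

section \<open>Equations of the trace\<close>

lemma trace_oplus_iso:
  fixes A :: "('p, 'a::finite) romdp" and B :: "('q, 'a) romdp"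
  assumes A: "A \<in> roMDP (l + m1) (l + n1)" and B: "B \<in> roMDP m2 n2"
  shows "trace l (m1 + m2) (n1 + n2) (A \<oplus> B) \<cong>\<^bsub>m1 + m2,n1 + n2\<^esub> (trace l m1 n1 A \<oplus> B)"
proof (rule romdp_isoI[where f = id])
  let ?L = "trace l (m1 + m2) (n1 + n2) (A \<oplus> B)" and ?R = "trace l m1 n1 A \<oplus> B"
  have AB: "A \<oplus> B \<in> roMDP (l + (m1 + m2)) (l + (n1 + n2))"
    using oplus_roMDP[OF A B] by (simp add: add.assoc)
  note T = trace_roMDP[OF A]
  show L: "?L \<in> roMDP (m1 + m2) (n1 + n2)" and "?R \<in> roMDP (m1 + m2) (n1 + n2)"
    by (rule trace_roMDP[OF AB], rule oplus_roMDP[OF T B])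
  show "bij_betw id (positions ?L) (positions ?R)" "reward ?R (id s) = reward ?L s" for s by simp_all
  have entry: "entry (A \<oplus> B) j = map_sum Inl id (entry A j)" if "j \<in> {1..l}" for j
    using that roMDP_D(1)[OF A] by simp
  fix x assume x: "x \<in> sources ?L"
  then have "x \<in> sources ?R" using roMDP_D(1)[OF B] by (cases x) auto
  from this roMDP_D(1)[OF T] have "same_weight ?L x ?R x id"
  proof (cases rule: sources_oplus_cases)
    case (left z)
    note z = untrace_source[OF A left(1)]
    have eq: "map_sum (\<lambda>i. i + l) id x = lift_left (map_sum (\<lambda>i. i + l) id z)"
      by (cases z) (auto simp: left)
    note flL = flow_trace[OF AB x flow_oplus_left[OF A B z flow_refl[OF A], folded eq]]
    note flR = flow_oplus_left[OF T B left(1) flow_trace[OF A left(1) flow_refl[OF A]], folded left(2)]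
    have "resolves l (n1 + n2) (entry (A \<oplus> B)) (map_sum Inl id u) t \<longleftrightarrow>
        (resolves l n1 (entry A) OO (\<lambda>v t. t = map_sum Inl id v)) u t" if "u \<in> targets A" for u t
      by (rule resolves_simulation[where Q = "positions A" and h = "map_sum Inl id" and h' = "map_sum Inl id"])
        (use that entry entry_traced[OF A] in \<open>auto simp: targets_traced[OF A]\<close>)
    then show ?thesis
      by (intro same_weightI[OF _ flL flR]) (auto simp: sum.map_id relcompp_apply)
  next
    case (right z)
    have eq: "map_sum (\<lambda>i. i + l) id x = lift_right (l + m1) z"
      by (cases z) (auto simp: right)
    note fl = flow_refl[OF B, of z]
    note flL = flow_trace[OF AB x flow_oplus_right[OF A B right(1) fl, folded eq]]
    note flR = flow_oplus_right[OF T B right(1) fl, folded right(2)]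
    \<comment> \<open>The exits of \<open>B\<close> come after the \<open>l + n1\<close> exits of
      \<open>A\<close>, so they leave the loop at once.\<close>
    have "resolves l (n1 + n2) (entry (A \<oplus> B)) (map_sum Inr (\<lambda>t. t + (l + n1)) u) t \<longleftrightarrow>
        t = map_sum Inr (\<lambda>t. t + n1) u" if "u \<in> targets B" for u t
    proof (cases u)
      case (Inr j)
      have eq: "map_sum Inr (\<lambda>t. t + (l + n1)) u = Inr ((j + n1) + l)" using Inr by simp
      show ?thesis unfolding eq using Inr that roMDP_D(2)[OF B] by simp
    qed simp
    then show ?thesis
      by (intro same_weightI[OF _ flL flR]) (auto simp: sum.map_id relcompp_apply)
  qed
  then show "same_weight ?L x ?R (map_sum id (map_prod id id) x) id"
    by (simp add: prod.map_id0 sum.map_id)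
qed

lemma trace_trace_iso:
  fixes A :: "('p, 'a::finite) romdp"
  assumes A: "A \<in> roMDP (l1 + l2 + m) (l1 + l2 + n)"
  shows "trace (l1 + l2) m n A \<cong>\<^bsub>m,n\<^esub> trace l2 m n (trace l1 (l2 + m) (l2 + n) A)"
proof (rule romdp_isoI[where f = id])
  let ?T = "trace l1 (l2 + m) (l2 + n) A"
  let ?L = "trace (l1 + l2) m n A" and ?R = "trace l2 m n ?T"
  have A': "A \<in> roMDP (l1 + (l2 + m)) (l1 + (l2 + n))" using A by (simp add: add.assoc)
  note T = trace_roMDP[OF A']
  show "?L \<in> roMDP m n" "?R \<in> roMDP m n" by (rule trace_roMDP[OF A], rule trace_roMDP[OF T])
  show "bij_betw id (positions ?L) (positions ?R)" "reward ?R (id s) = reward ?L s" for s by simp_all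
  fix x assume x: "x \<in> sources ?L"
  define y where "y = map_sum (\<lambda>i. i + (l1 + l2)) id x"
  have x': "x \<in> sources ?R" "map_sum (\<lambda>i. i + l2) id x \<in> sources ?T"
    using x by (cases x; auto)+
  have y: "y = map_sum (\<lambda>i. i + l1) id (map_sum (\<lambda>i. i + l2) id x)"
    by (cases x) (auto simp: y_def)
  note flL = flow_trace[OF A x flow_refl[OF A]]
  note flR = flow_trace[OF T x'(1) flow_trace[OF A' x'(2) flow_refl[OF A']]]
  have "same_weight ?L x ?R x id"
    by (rule same_weightI[OF _ flL[folded y_def] flR[folded y]])
      (simp_all add: resolves_trace[OF A'] sum.map_id relcompp_apply)
  then show "same_weight ?L x ?R (map_sum id (map_prod id id) x) id"
    by (simp add: prod.map_id0 sum.map_id)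
qed

text \<open>The identity hands the traced wires directly to \<open>A\<close>. Hence the loop is that
  of \<open>A\<close> with embedded positions, and \<open>B\<close> is passed before the loop is
  entered.\<close>

lemma trace_ident_oplus_seq_comp_iso:
  fixes A :: "('p, 'a::finite) romdp" and B :: "('q, 'a) romdp"
  assumes A: "A \<in> roMDP (l + k) (l + n)" and B: "B \<in> roMDP m k"
  shows "trace l m n (((\<I> l :: ('i, 'a) romdp) \<oplus> B) \<Zcomp> A) \<cong>\<^bsub>m,n\<^esub> (B \<Zcomp> trace l k n A)"
proof (rule romdp_isoI)
  let ?I = "\<I> l :: ('i, 'a) romdp"
  let ?C = "(?I \<oplus> B) \<Zcomp> A"
  let ?L = "trace l m n ?C" and ?R = "B \<Zcomp> trace l k n A"
  let ?f = "map_sum projr id :: ('i + 'q) + 'p \<Rightarrow> 'q + 'p"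
  note I = ident_roMDP[of l, where ?'q = 'i and ?'a = 'a]
  note IB = oplus_roMDP[OF I B] and T = trace_roMDP[OF A]
  note C = seq_comp_roMDP[OF IB A]
  show "?L \<in> roMDP m n" "?R \<in> roMDP m n" by (rule trace_roMDP[OF C], rule seq_comp_roMDP[OF B T])
  show f: "bij_betw ?f (positions ?L) (positions ?R)"
    by (rule bij_betw_witness[where g = "map_sum Inr id"]) auto
  note inj = bij_betw_imp_inj_on[OF f]
  show "reward ?R (?f s) = reward ?L s" if "s \<in> positions ?L" for s using that by auto
  have sim: "resolves l n (entry ?C) (map_sum Inr id u) t \<longleftrightarrow>
      (resolves l n (entry A) OO (\<lambda>v t. t = map_sum Inr id v)) u t" if "u \<in> targets A" for u t
    by (rule resolves_simulation[where Q = "positions A" and h = "map_sum Inr id" and h' = "map_sum Inr id"])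
      (use that entry_traced[OF A] in \<open>auto simp: targets_traced[OF A]\<close>)
  have collapse: "map_sum ?f id (map_sum Inr id v) = map_sum Inr id v" for v :: "'p + nat"
    by (cases v) auto
  fix x assume x: "x \<in> sources ?L"
  show "same_weight ?L x ?R (map_sum id (map_prod ?f id) x) ?f"
  proof (cases "\<exists>p a. x = Inr (Inr p, a)")
    case True
    then obtain p a where xp: "x = Inr (Inr p, a)" by blast
    then have p: "p \<in> positions A" "Inr (p, a) \<in> sources (trace l k n A)" using x by auto
    note fl = flow_refl[OF A, of "Inr (p, a)"]
    have "flow ?L (Inr (Inr p, a)) (targets A)
        (((=) OO (\<lambda>u v. v = map_sum Inr id u)) OO resolves l n (entry ?C)) (weight A (Inr (p, a)))"
      using flow_trace[OF C x] flow_seq_comp_right[OF IB A p(1) fl] by (simp add: xp)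
    moreover have "flow ?R (Inr (Inr p, a)) (targets A)
        (((=) OO resolves l n (entry A)) OO (\<lambda>u v. v = map_sum Inr id u)) (weight A (Inr (p, a)))"
      using flow_trace[OF A p(2)] fl p(1) by (intro flow_seq_comp_right[OF B T]) simp_all
    ultimately have "same_weight ?L (Inr (Inr p, a)) ?R (Inr (Inr p, a)) ?f"
      by (rule same_weightI[OF inj]) (auto simp: relcompp_apply sim collapse)
    then show ?thesis by (simp add: xp)
  next
    case False
    then obtain z where z: "z \<in> sources B" "map_sum id (map_prod ?f id) x = lift_left z"
        "map_sum (\<lambda>i. i + l) id x = lift_left (lift_right l z)"
    proof (cases x)
      case (Inl i)
      then show thesis using x that[of "Inl i"] roMDP_D(1)[OF B] by simp
    next
      case (Inr y)
      then obtain q a where "x = Inr (Inl (Inr q), a)" "q \<in> positions B"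
        using x False by (cases y) auto
      then show thesis using that[of "Inr (q, a)"] by simp
    qed
    have z': "lift_right l z \<in> sources (?I \<oplus> B)" using z(1) by (cases z) auto
    note fl = flow_refl[OF B, of z]
    note flL = flow_trace[OF C x, unfolded z(3),
        OF flow_seq_comp_left[OF IB A z' flow_oplus_right[OF I B z(1) fl]]]
    note flR = flow_seq_comp_left[OF B T z(1) fl]
    have "t = then_entry (trace l k n A) u \<longleftrightarrow>
        (\<exists>v. resolves l n (entry ?C) (then_entry A (map_sum Inr (\<lambda>t. t + l) u)) v \<and>
          t = map_sum ?f id v)" if u: "u \<in> targets B" for u t
    proof (cases u)
      case (Inr j)
      then have j: "j \<in> {1..k}" using u roMDP_D(2)[OF B] by simp
      then have "entry A (j + l) \<in> targets A" by (intro roMDP_D(5)[OF A]) auto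
      then show ?thesis
        using Inr by (auto simp: sim relcompp_apply trace_entry_resolves[OF A j] collapse)
    qed auto
    then have "same_weight ?L x ?R (lift_left z) ?f"
      by (intro same_weightI[OF inj flL flR]) (auto simp: relcompp_apply)
    then show ?thesis by (simp add: z(2))
  qed
qed

text \<open>The map \<open>then_entry\<close> of the identity plus \<open>B\<close> fixes the traced
  wires, so it simulates the loop of \<open>A\<close>; on leaving that loop, it continues into
  \<open>B\<close>.\<close>

lemma trace_seq_comp_ident_oplus_iso:
  fixes A :: "('p, 'a::finite) romdp" and B :: "('q, 'a) romdp"
  assumes A: "A \<in> roMDP (l + m) (l + k)" and B: "B \<in> roMDP k n"
  shows "trace l m n (A \<Zcomp> ((\<I> l :: ('i, 'a) romdp) \<oplus> B)) \<cong>\<^bsub>m,n\<^esub> (trace l m k A \<Zcomp> B)"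
proof (rule romdp_isoI)
  let ?I = "\<I> l :: ('i, 'a) romdp"
  let ?C = "A \<Zcomp> (?I \<oplus> B)"
  let ?L = "trace l m n ?C" and ?R = "trace l m k A \<Zcomp> B"
  let ?f = "map_sum id projr :: 'p + ('i + 'q) \<Rightarrow> 'p + 'q"
  \<comment> \<open>Embeds the targets of the right-hand side into those of the left-hand side,
    which have an additional empty summand; \<open>collapse\<close> undoes this.\<close>
  let ?g = "map_sum (map_sum id Inr) id :: ('p + 'q) + nat \<Rightarrow> ('p + 'i + 'q) + nat"
  note I = ident_roMDP[of l, where ?'q = 'i and ?'a = 'a]
  note IB = oplus_roMDP[OF I B] and T = trace_roMDP[OF A]
  note C = seq_comp_roMDP[OF A IB]
  show "?L \<in> roMDP m n" "?R \<in> roMDP m n" by (rule trace_roMDP[OF C], rule seq_comp_roMDP[OF T B])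
  show f: "bij_betw ?f (positions ?L) (positions ?R)"
    by (rule bij_betw_witness[where g = "map_sum id Inr"]) auto
  note inj = bij_betw_imp_inj_on[OF f]
  show "reward ?R (?f s) = reward ?L s" if "s \<in> positions ?L" for s using that by auto
  have B_targets: "resolves l n (entry ?C) (map_sum Inr id (map_sum Inr (\<lambda>t. t + l) u)) t \<longleftrightarrow>
      t = ?g (map_sum Inr id u)" if "u \<in> targets B" for u t
    using that roMDP_D(2)[OF B] by (cases u) auto
  have sim: "resolves l n (entry ?C) (then_entry (?I \<oplus> B) u) t \<longleftrightarrow>
      (resolves l k (entry A) OO (\<lambda>v t. t = ?g (then_entry B v))) u t" if "u \<in> targets A" for u t
  proof (rule resolves_simulation[where Q = "positions A" and h = "then_entry (?I \<oplus> B)"])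
    fix i t assume i: "i \<in> {1..k}"
    then have "entry B i \<in> targets B" by (intro roMDP_D(5)[OF B]) auto
    moreover have "entry (?I \<oplus> B) (i + l) = map_sum Inr (\<lambda>t. t + l) (entry B i)"
      using oplus_simps(6)[of i ?I B] i by simp
    ultimately show "resolves l n (entry ?C) (then_entry (?I \<oplus> B) (Inr (i + l))) t \<longleftrightarrow>
        t = ?g (then_entry B (Inr i))"
      using B_targets by simp
  qed (use that entry_traced[OF A] in \<open>auto simp: targets_traced[OF A]\<close>)
  have collapse: "map_sum ?f id (?g v) = v" for v
  proof (cases v)
    case (Inl s)
    then show ?thesis by (cases s) auto
  qed simp
  fix x assume x: "x \<in> sources ?L"
  show "same_weight ?L x ?R (map_sum id (map_prod ?f id) x) ?f"
  proof (cases "\<exists>s a. x = Inr (Inr s, a)")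
    case True
    then obtain q a where xq: "x = Inr (Inr (Inr q), a)" using x by auto
    then have q: "q \<in> positions B" "Inr q \<in> positions (?I \<oplus> B)" using x by auto
    note fl = flow_refl[OF B, of "Inr (q, a)"]
    have "flow ?L (Inr (Inr (Inr q), a)) (targets B)
        ((((=) OO (\<lambda>u v. v = map_sum Inr (\<lambda>t. t + l) u)) OO (\<lambda>u v. v = map_sum Inr id u))
          OO resolves l n (entry ?C)) (weight B (Inr (q, a)))"
      using flow_trace[OF C x] flow_seq_comp_right[OF A IB q(2) flow_oplus_right_position[OF I B q(1) fl]]
      by (simp add: xq)
    moreover note flow_seq_comp_right[OF T B q(1) fl]
    ultimately have "same_weight ?L (Inr (Inr (Inr q), a)) ?R (Inr (Inr q, a)) ?f"
      by (rule same_weightI[OF inj]) (auto simp: relcompp_apply B_targets collapse)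
    then show ?thesis by (simp add: xq)
  next
    case False
    then obtain z where z: "z \<in> sources (trace l m k A)" "map_sum id (map_prod ?f id) x = lift_left z"
        "map_sum (\<lambda>i. i + l) id x = lift_left (map_sum (\<lambda>i. i + l) id z)"
    proof (cases x)
      case (Inl i)
      then show thesis using x that[of "Inl i"] by simp
    next
      case (Inr y)
      then obtain p a where "x = Inr (Inl p, a)" "p \<in> positions A"
        using x False by (cases y) auto
      then show thesis using that[of "Inr (p, a)"] by simp
    qed
    note fl = flow_refl[OF A, of "map_sum (\<lambda>i. i + l) id z"]
    note flL = flow_trace[OF C x, unfolded z(3), OF flow_seq_comp_left[OF A IB untrace_source[OF A z(1)] fl]]
    note flR = flow_seq_comp_left[OF T B z(1) flow_trace[OF A z(1) fl]]
    have "same_weight ?L x ?R (lift_left z) ?f"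
      by (rule same_weightI[OF inj flL flR]) (auto simp: relcompp_apply sim collapse)
    then show ?thesis by (simp add: z(2))
  qed
qed

text \<open>The loop on the left is cut in front of \<open>B\<close>, the one on the right in front
  of \<open>A\<close>. Starting at a target of \<open>A\<close>, the right-hand side passes through
  \<open>B\<close> once before its cut, and this aligns the two loops in \<open>sim\<close>.\<close>

lemma trace_dinaturality_iso:
  fixes A :: "('p, 'a::finite) romdp" and B :: "('q, 'a) romdp"
  assumes A: "A \<in> roMDP (k + m) (l + n)" and B: "B \<in> roMDP l k"
  shows "trace l m n ((B \<oplus> (\<I> m :: ('i, 'a) romdp)) \<Zcomp> A) \<cong>\<^bsub>m,n\<^esub>
    trace k m n (A \<Zcomp> (B \<oplus> (\<I> n :: ('j, 'a) romdp)))"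
proof (rule romdp_isoI)
  let ?Im = "\<I> m :: ('i, 'a) romdp" and ?In = "\<I> n :: ('j, 'a) romdp"
  let ?C = "(B \<oplus> ?Im) \<Zcomp> A" and ?D = "A \<Zcomp> (B \<oplus> ?In)"
  let ?L = "trace l m n ?C" and ?R = "trace k m n ?D"
  let ?f = "case_sum (Inr \<circ> Inl \<circ> projl) Inl :: ('q + 'i) + 'p \<Rightarrow> 'p + ('q + 'j)"
  note Im = ident_roMDP[of m, where ?'q = 'i and ?'a = 'a]
    and In = ident_roMDP[of n, where ?'q = 'j and ?'a = 'a]
  note BIm = oplus_roMDP[OF B Im] and BIn = oplus_roMDP[OF B In]
  note C = seq_comp_roMDP[OF BIm A] and D = seq_comp_roMDP[OF A BIn]
  show L: "?L \<in> roMDP m n" and R: "?R \<in> roMDP m n"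
    by (rule trace_roMDP[OF C], rule trace_roMDP[OF D])
  show f: "bij_betw ?f (positions ?L) (positions ?R)"
    by (rule bij_betw_witness[where g = "case_sum Inr (Inl \<circ> Inl \<circ> projl)"]) auto
  note inj = bij_betw_imp_inj_on[OF f]
  show "reward ?R (?f s) = reward ?L s" if "s \<in> positions ?L" for s using that by auto
  have sim: "resolves k n (entry ?D) (then_entry (B \<oplus> ?In) u) t' \<longleftrightarrow>
      (\<exists>t. resolves l n (entry ?C) (map_sum Inr id u) t \<and> t' = map_sum ?f id t)"
    if "u \<in> targets A" for u t'
  proof (rule resolves_dinatural[where E_A = "entry A" and E_B = "entry B" and b = "Inl \<circ> Inl"
        and Q_A = "positions A" and Q_B = "positions B" and h = "then_entry (B \<oplus> ?In)"])
    show "u \<in> positions A <+> {1..l + n}" using that by (simp add: targets_def roMDP_D(2)[OF A])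
    show "entry B j \<in> positions B <+> {1..k}" if "j \<in> {1..l}" for j
      using that roMDP_D(2,5)[OF B] by (simp add: targets_def)
    show "entry A i \<in> positions A <+> {1..l + n}" if "i \<in> {1..k}" for i
      using that roMDP_D(2)[OF A] roMDP_D(5)[OF A, of i] by (simp add: targets_def)
    show "entry ?C j = case_sum (\<lambda>q. Inl ((Inl \<circ> Inl) q)) (\<lambda>i. map_sum Inr id (entry A i)) (entry B j)"
      if "j \<in> {1..l}" for j
      using that roMDP_D(1)[OF B] by (cases "entry B j") auto
    show "then_entry (B \<oplus> ?In) (Inr (i + l)) = Inr (i + k)" if "i \<in> {1..n}" for i
      using that roMDP_D(1,2)[OF B] oplus_simps(6)[of i B ?In] by simp
    show "then_entry (B \<oplus> ?In) (Inr j) = map_sum (\<lambda>q. ?f ((Inl \<circ> Inl) q)) id (entry B j)"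
      if "j \<in> {1..l}" for j
      using that roMDP_D(1)[OF B] by (cases "entry B j") auto
  qed simp_all
  fix x assume x: "x \<in> sources ?L"
  show "same_weight ?L x ?R (map_sum id (map_prod ?f id) x) ?f"
  proof (cases x)
    case (Inl i)
    then have i: "i \<in> {1..m}" using x by simp
    \<comment> \<open>On the left the identity passes the entrance on to \<open>A\<close>, on the
      right \<open>A\<close> is entered directly; both continue from
      \<open>entry A (i + k)\<close>.\<close>
    have "entry A (i + k) \<in> targets A" using i by (intro roMDP_D(5)[OF A]) auto
    moreover have "entry ?C (i + l) = map_sum Inr id (entry A (i + k))"
      using i roMDP_D(1,2)[OF B] oplus_simps(6)[of i B ?Im] by simp
    ultimately have "resolves k n (entry ?D) (entry ?D (i + k)) (map_sum ?f id (trace_entry l n ?C i))"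
      using sim[of "entry A (i + k)"] trace_entry_resolves[OF C i] unfolding seq_comp_simps(5)[of A] by auto
    from trace_entry_eqI[OF D i this] show ?thesis
      using same_weight_entryI[OF L R inj i] by (simp add: Inl)
  next
    case (Inr y)
    then obtain s a where s: "x = Inr (s, a)" "s \<in> positions ?L" using x by (cases y) auto
    then have xR: "Inr (?f s, a) \<in> sources ?R" by auto
    from s(2) have "same_weight ?L (Inr (s, a)) ?R (Inr (?f s, a)) ?f"
    proof (cases s)
      case (Inr p)
      then have p: "p \<in> positions A" using s(2) by auto
      note fl = flow_refl[OF A, of "Inr (p, a)"]
      have "flow ?L (Inr (s, a)) (targets A)
          (((=) OO (\<lambda>u v. v = map_sum Inr id u)) OO resolves l n (entry ?C)) (weight A (Inr (p, a)))"
        using flow_trace[OF C x] flow_seq_comp_right[OF BIm A p fl] by (simp add: s Inr)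
      moreover have "flow ?R (Inr (?f s, a)) (targets A)
          (((=) OO (\<lambda>u v. v = then_entry (B \<oplus> ?In) u)) OO resolves k n (entry ?D)) (weight A (Inr (p, a)))"
        using flow_trace[OF D xR] flow_seq_comp_left_position[OF A BIn p fl] by (simp add: Inr)
      ultimately show ?thesis
        by (rule same_weightI[OF inj]) (simp add: relcompp_apply sim)
    next
      case (Inl s')
      then obtain q where q: "s = Inl (Inl q)" "q \<in> positions B"
        "Inl q \<in> positions (B \<oplus> ?Im)" "Inl q \<in> positions (B \<oplus> ?In)" using s(2) by auto
      note fl = flow_refl[OF B, of "Inr (q, a)"]
      have "flow ?L (Inr (s, a)) (targets B)
          ((((=) OO (\<lambda>u v. v = map_sum Inl id u)) OO (\<lambda>u v. v = then_entry A u))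
            OO resolves l n (entry ?C)) (weight B (Inr (q, a)))"
        using flow_trace[OF C x]
          flow_seq_comp_left_position[OF BIm A q(3) flow_oplus_left_position[OF B Im q(2) fl]]
        by (simp add: s(1) q(1))
      moreover have "flow ?R (Inr (?f s, a)) (targets B)
          ((((=) OO (\<lambda>u v. v = map_sum Inl id u)) OO (\<lambda>u v. v = map_sum Inr id u))
            OO resolves k n (entry ?D)) (weight B (Inr (q, a)))"
        using flow_trace[OF D xR]
          flow_seq_comp_right[OF A BIn q(4) flow_oplus_left_position[OF B In q(2) fl]]
        by (simp add: q(1))
      \<comment> \<open>From an exit \<open>i\<close> of \<open>B\<close>, the left-hand side
        continues in \<open>A\<close> by composition and the right-hand side by one feedback step;
        after that \<open>sim\<close> applies to \<open>entry A i\<close>.\<close>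
      moreover have "resolves k n (entry ?D) (map_sum Inr id (map_sum Inl id u)) t' \<longleftrightarrow>
          (\<exists>t. resolves l n (entry ?C) (then_entry A (map_sum Inl id u)) t \<and> t' = map_sum ?f id t)"
        if u: "u \<in> targets B" for u t'
      proof (cases u)
        case (Inr i)
        then have i: "i \<in> {1..k}" using u roMDP_D(2)[OF B] by simp
        then have "entry A i \<in> targets A" by (intro roMDP_D(5)[OF A]) auto
        from sim[OF this] show ?thesis
          using Inr i by (simp add: resolves_feedback_iff)
      qed auto
      ultimately show ?thesis
        by (intro same_weightI[OF inj]) (assumption | simp add: relcompp_apply)+
    qed
    then show ?thesis by (simp add: s)
  qed
qed

theorem theorem1:
  shows
    \<comment> \<open>;-Unit\<close>
    "(\<forall>m n. \<forall>A \<in> (roMDP m n :: ('p, 'a::finite) romdp set).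
        ((\<I> m :: ('i, 'a) romdp) \<Zcomp> A) \<cong>\<^bsub>m,n\<^esub> A \<and>
        A \<cong>\<^bsub>m,n\<^esub> (A \<Zcomp> (\<I> n :: ('i, 'a) romdp))) \<and>
    \<comment> \<open>;-Assoc\<close>
     (\<forall>m n k l. \<forall>A \<in> (roMDP m n :: ('p, 'a) romdp set). \<forall>B \<in> (roMDP n k :: ('q, 'a) romdp set).
      \<forall>C \<in> (roMDP k l :: ('r, 'a) romdp set).
        (A \<Zcomp> (B \<Zcomp> C)) \<cong>\<^bsub>m,l\<^esub> ((A \<Zcomp> B) \<Zcomp> C)) \<and>
    \<comment> \<open>sum-Assoc\<close>
     (\<forall>m1 n1 m2 n2 m3 n3. \<forall>A \<in> (roMDP m1 n1 :: ('p, 'a) romdp set).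
      \<forall>B \<in> (roMDP m2 n2 :: ('q, 'a) romdp set). \<forall>C \<in> (roMDP m3 n3 :: ('r, 'a) romdp set).
        ((A \<oplus> B) \<oplus> C) \<cong>\<^bsub>m1 + m2 + m3,n1 + n2 + n3\<^esub> (A \<oplus> (B \<oplus> C))) \<and>
    \<comment> \<open>Bifunc1\<close>
     (\<forall>m n. ((\<I> m :: ('i, 'a) romdp) \<oplus> (\<I> n :: ('j, 'a) romdp))
        \<cong>\<^bsub>m + n,m + n\<^esub> (\<I> (m + n) :: ('k, 'a) romdp)) \<and>
    \<comment> \<open>Bifunc2\<close>
     (\<forall>m1 k1 n1 m2 k2 n2.
      \<forall>A \<in> (roMDP m1 k1 :: ('p, 'a) romdp set). \<forall>B \<in> (roMDP m2 k2 :: ('q, 'a) romdp set).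
      \<forall>C \<in> (roMDP k1 n1 :: ('r, 'a) romdp set). \<forall>D \<in> (roMDP k2 n2 :: ('s, 'a) romdp set).
        ((A \<oplus> B) \<Zcomp> (C \<oplus> D)) \<cong>\<^bsub>m1 + m2,n1 + n2\<^esub> ((A \<Zcomp> C) \<oplus> (B \<Zcomp> D))) \<and>
    \<comment> \<open>Swap1\<close>
     (\<forall>m. (\<S> m 0 :: ('i, 'a) romdp) \<cong>\<^bsub>m,m\<^esub> (\<I> m :: ('j, 'a) romdp)) \<and>
    \<comment> \<open>Swap2\<close>
     (\<forall>l m n. (\<S> l (m + n) :: ('g, 'a) romdp) \<cong>\<^bsub>l + m + n,m + n + l\<^esub>
        (((\<S> l m :: ('h, 'a) romdp) \<oplus> (\<I> n :: ('i, 'a) romdp)) \<Zcomp>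
         ((\<I> m :: ('j, 'a) romdp) \<oplus> (\<S> l n :: ('k, 'a) romdp)))) \<and>
    \<comment> \<open>Swap3\<close>
     (\<forall>m n. ((\<S> m n :: ('i, 'a) romdp) \<Zcomp> (\<S> n m :: ('j, 'a) romdp))
        \<cong>\<^bsub>m + n,m + n\<^esub> (\<I> (m + n) :: ('k, 'a) romdp)) \<and>
    \<comment> \<open>Vanishing1\<close>
     (\<forall>m. trace 0 m m (\<I> m :: ('i, 'a) romdp) \<cong>\<^bsub>m,m\<^esub> (\<I> m :: ('j, 'a) romdp)) \<and>
    \<comment> \<open>Vanishing2\<close>
     (\<forall>l1 l2 m n. \<forall>A \<in> (roMDP (l1 + l2 + m) (l1 + l2 + n) :: ('p, 'a) romdp set).
        trace (l1 + l2) m n A \<cong>\<^bsub>m,n\<^esub> trace l2 m n (trace l1 (l2 + m) (l2 + n) A)) \<and>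
    \<comment> \<open>Superposing\<close>
     (\<forall>l m1 m2 n1 n2. \<forall>A \<in> (roMDP (l + m1) (l + n1) :: ('p, 'a) romdp set).
      \<forall>B \<in> (roMDP m2 n2 :: ('q, 'a) romdp set).
        trace l (m1 + m2) (n1 + n2) (A \<oplus> B) \<cong>\<^bsub>m1 + m2,n1 + n2\<^esub> (trace l m1 n1 A \<oplus> B)) \<and>
    \<comment> \<open>Yanking\<close>
     (\<forall>m. trace m m m (\<S> m m :: ('i, 'a) romdp) \<cong>\<^bsub>m,m\<^esub> (\<I> m :: ('j, 'a) romdp)) \<and>
    \<comment> \<open>Naturality1\<close>
     (\<forall>l m k n. \<forall>A \<in> (roMDP (l + k) (l + n) :: ('p, 'a) romdp set).
      \<forall>B \<in> (roMDP m k :: ('q, 'a) romdp set).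
        trace l m n (((\<I> l :: ('i, 'a) romdp) \<oplus> B) \<Zcomp> A) \<cong>\<^bsub>m,n\<^esub> (B \<Zcomp> trace l k n A)) \<and>
    \<comment> \<open>Naturality2\<close>
     (\<forall>l m k n. \<forall>A \<in> (roMDP (l + m) (l + k) :: ('p, 'a) romdp set).
      \<forall>B \<in> (roMDP k n :: ('q, 'a) romdp set).
        trace l m n (A \<Zcomp> ((\<I> l :: ('i, 'a) romdp) \<oplus> B)) \<cong>\<^bsub>m,n\<^esub> (trace l m k A \<Zcomp> B)) \<and>
    \<comment> \<open>Dinaturality\<close>
     (\<forall>k l m n. \<forall>A \<in> (roMDP (k + m) (l + n) :: ('p, 'a) romdp set).
      \<forall>B \<in> (roMDP l k :: ('q, 'a) romdp set).
        trace l m n ((B \<oplus> (\<I> m :: ('i, 'a) romdp)) \<Zcomp> A) \<cong>\<^bsub>m,n\<^esub>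
        trace k m n (A \<Zcomp> (B \<oplus> (\<I> n :: ('j, 'a) romdp))))"
  by (intro conjI allI ballI)
    (rule ident_seq_comp_iso seq_comp_ident_iso seq_comp_assoc_iso oplus_assoc_iso ident_oplus_iso
    oplus_seq_comp_iso swap_0_iso swap_hexagon_iso swap_swap_iso trace_ident_iso trace_trace_iso
    trace_oplus_iso trace_swap_iso trace_ident_oplus_seq_comp_iso trace_seq_comp_ident_oplus_iso
    trace_dinaturality_iso; assumption)+

end
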